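(* Let $n\ge 1$, let $f\in C([0,1]\times[0,\infty),[0,\infty))$, let $\alpha\ge 0$, $\beta_i\ge 0$ ($1\le i\le n$), $0<\eta_1<\eta_2<\dots<\eta_n<1$, and suppose $\alpha+\sum_{i=1}^n\beta_i<1$. Put $k=1-\big(\alpha+\sum_{i=1}^n\beta_i\big)$ and $\Lambda_1=6k$. Assume that: (i) $f_0=f_\infty=\infty$; (ii) there exist constants $\rho_1>0$ and $M_1\in(0,\Lambda_1]$ such that $f(t,u)\le M_1\rho_1$ for all $u\in(0,\rho_1]$ and $t\in[0,1]$. Then the boundary value problem $$u''''(t)+f(t,u(t))=0,\quad t\in(0,1),$$ $$u'(0)=u'(1)=u''(0)=0,\qquad u(0)=\alpha\int_0^1u(s)\,ds+\sum_{i=1}^n\beta_iu(\eta_i)$$ has at least two positive solutions $u_1$ and $u_2$ such that $$0<\|u_1\|<\rho_1<\|u_2\|.$$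
   Context: $\|u\|=\sup_{t\in[0,1]}|u(t)|$. The limits, understood in $[0,\infty]$, are $$f_0=\lim_{u\to0^+}\Big\{\min_{0\le t\le1}\frac{f(t,u)}{u}\Big\},\qquad f_\infty=\lim_{u\to+\infty}\Big\{\min_{0\le t\le1}\frac{f(t,u)}{u}\Big\};$$ a hypothesis such as $f_0=\infty$ means that the limit exists and has the indicated value. A solution is a function $u\in C^4([0,1])$ satisfying the differential equation and the boundary conditions; a positive solution is a solution $u$ with $u(t)>0$ for all $t\in(0,1)$. *)

theory Defs
  imports "HOL-Analysis.Analysis"
begin

text \<open>
  Derivatives are taken within the closed interval, i.e. they are one-sided at the endpoints.
  Only the values at points of \<open>{0..1}\<close> are meaningful.
\<close>

definition deriv01 :: "(real \<Rightarrow> real) \<Rightarrow> real \<Rightarrow> real" where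
  "deriv01 u t = vector_derivative u (at t within {0..1})"

definition C_diff01 :: "nat \<Rightarrow> (real \<Rightarrow> real) \<Rightarrow> bool" where
  "C_diff01 m u \<longleftrightarrow>
     (\<forall>j<m. (deriv01 ^^ j) u differentiable_on {0..1}) \<and>
     continuous_on {0..1} ((deriv01 ^^ m) u)"

definition sup_norm01 :: "(real \<Rightarrow> real) \<Rightarrow> real" where
  "sup_norm01 u = (SUP t\<in>{0..1}. \<bar>u t\<bar>)"

text \<open>
  For \<open>u > 0\<close> the infimum below is a minimum, since \<open>f\<close> is assumed continuous wherever
  this is used.
\<close>

definition min_quot :: "(real \<Rightarrow> real \<Rightarrow> real) \<Rightarrow> real \<Rightarrow> real" where
  "min_quot f u = (INF t\<in>{0..1}. f t u / u)"

text \<open>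
  ``The limit exists in the extended reals and equals \<open>L\<close>''.
\<close>

definition f_zero_is :: "(real \<Rightarrow> real \<Rightarrow> real) \<Rightarrow> ereal \<Rightarrow> bool" where
  "f_zero_is f L \<longleftrightarrow> ((\<lambda>u. ereal (min_quot f u)) \<longlongrightarrow> L) (at_right 0)"

definition f_infinity_is :: "(real \<Rightarrow> real \<Rightarrow> real) \<Rightarrow> ereal \<Rightarrow> bool" where
  "f_infinity_is f L \<longleftrightarrow> ((\<lambda>u. ereal (min_quot f u)) \<longlongrightarrow> L) at_top"

text \<open>
  The function \<open>f\<close> is only given on \<open>[0,1] \<times> [0,\<infinity>)\<close>, so a solution has to
  take values in \<open>[0,\<infinity>)\<close> for the equation to make sense.
\<close>

definition bvp_solution ::
  "(real \<Rightarrow> real \<Rightarrow> real) \<Rightarrow> real \<Rightarrow> nat \<Rightarrow> (nat \<Rightarrow> real) \<Rightarrow> (nat \<Rightarrow> real) \<Rightarrow> (real \<Rightarrow> real) \<Rightarrow> bool"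
where
  "bvp_solution f \<alpha> n \<beta> \<eta> u \<longleftrightarrow>
     C_diff01 4 u \<and>
     (\<forall>t\<in>{0..1}. 0 \<le> u t) \<and>
     (\<forall>t\<in>{0<..<1}. (deriv01 ^^ 4) u t + f t (u t) = 0) \<and>
     deriv01 u 0 = 0 \<and> deriv01 u 1 = 0 \<and> (deriv01 ^^ 2) u 0 = 0 \<and>
     u 0 = \<alpha> * integral {0..1} u + (\<Sum>i=1..n. \<beta> i * u (\<eta> i))"

definition positive_bvp_solution ::
  "(real \<Rightarrow> real \<Rightarrow> real) \<Rightarrow> real \<Rightarrow> nat \<Rightarrow> (nat \<Rightarrow> real) \<Rightarrow> (nat \<Rightarrow> real) \<Rightarrow> (real \<Rightarrow> real) \<Rightarrow> bool"
where
  "positive_bvp_solution f \<alpha> n \<beta> \<eta> u \<longleftrightarrow>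
     bvp_solution f \<alpha> n \<beta> \<eta> u \<and> (\<forall>t\<in>{0<..<1}. 0 < u t)"

end

theory Submission
  imports Defs "HOL-Complex_Analysis.Great_Picard"
begin

text \<open>
  Let \<open>T u\<close> denote the solution of the linear problem with right-hand side \<open>h s = f s (u s)\<close>.
  Its kernel is Green's function plus a weight that accounts for the nonlocal condition.
  Every \<open>T u\<close> is nondecreasing and satisfies \<open>(T u)(t) \<ge> t\<^sup>3 * (T u)(1)\<close>. In the cone of such
  functions the norm is the value at \<open>1\<close>, and a function of norm \<open>r\<close> is comparable to \<open>r\<close> on the
  middle half of the interval. Therefore \<open>f\<^sub>0 = \<infinity>\<close> makes \<open>T\<close> expand functions of small norm,
  \<open>f\<^sub>\<infinity> = \<infinity>\<close> makes it expand functions of large norm, and the bound on \<open>f\<close> up to \<open>\<rho>\<^sub>1\<close> makes it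
  compress functions of norm \<open>\<rho>\<^sub>1\<close>. Krasnoselskii's theorem gives a fixed point in each of the two
  annuli separated by \<open>\<rho>\<^sub>1\<close>; none has norm \<open>\<rho>\<^sub>1\<close>, because compression is strict.

  The fixed points are obtained from Brouwer's theorem in dimension four. Replace the integral by
  a Riemann sum with \<open>N\<close> nodes and add a small constant \<open>\<epsilon>\<close>. Because Green's function is a
  Volterra kernel up to a term of product form, the discrete unknowns are determined recursively
  by two parameters, as in a shooting method. Two more parameters, a multiplier \<open>\<mu>\<close> and a target
  norm \<open>r\<close>, are adjusted so that a fixed point satisfies \<open>u = \<mu> * (\<epsilon> + T u)\<close> and has norm \<open>r\<close>;
  the behaviour of \<open>T\<close> at the two ends of the annulus then forces \<open>\<mu> = 1\<close>
  (\<open>discrete_annulus_fixed_point\<close>, \<open>quadrature_fixed_point\<close>). Finally \<open>N\<close> tends to infinity and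
  \<open>\<epsilon>\<close> to zero, by the Arzela-Ascoli theorem (\<open>mild_solution_exists\<close>), and the limit is
  differentiated (\<open>mild_solution_is_positive_bvp_solution\<close>).
\<close>

section \<open>Discrete equations with a Volterra part\<close>

text \<open>
  A kernel of the form \<open>b j + p i * q j - v i j\<close> with \<open>v i j = 0\<close> for \<open>i \<le> j\<close> is a
  Volterra kernel plus two products. If the two sums that involve \<open>b\<close> and \<open>q\<close> are replaced
  by free parameters \<open>a\<close> and \<open>c\<close>, then the unknowns can be computed one after the other:
  the whole vector is an explicit continuous function of \<open>(a, c, \<mu>)\<close>, whatever its length.
\<close>
fun volterra_step ::
  "(nat \<Rightarrow> real) \<Rightarrow> (nat \<Rightarrow> nat \<Rightarrow> real) \<Rightarrow> (nat \<Rightarrow> real \<Rightarrow> real) \<Rightarrow> real \<Rightarrow> real \<Rightarrow> real \<Rightarrow> nat \<Rightarrow> real"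
where
  "volterra_step p v F a c \<mu> i =
     a + c * p i - \<mu> * (\<Sum>j<i. v i j * F j (volterra_step p v F a c \<mu> j))"

declare volterra_step.simps [simp del]

lemma continuous_volterra_step:
  assumes F: "\<And>j. continuous_on UNIV (F j)"
    and a: "continuous_on S a" and c: "continuous_on S c" and \<mu>: "continuous_on S \<mu>"
  shows "continuous_on S (\<lambda>z. volterra_step p v F (a z) (c z) (\<mu> z) i)"
proof (induction i rule: less_induct)
  case (less i)
  have "continuous_on S (\<lambda>z. F j (volterra_step p v F (a z) (c z) (\<mu> z) j))" if "j < i" for j
    using continuous_on_compose2[OF F less[OF that]] by auto
  then show ?case
    by (subst volterra_step.simps) (auto intro!: continuous_intros a c \<mu>)
qed

text \<open>
  Brouwer's theorem in a fixed dimension suffices for systems of arbitrary length: only the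
  parameters \<open>a\<close>, \<open>c\<close>, \<open>\<mu>\<close> have to be matched. The fourth coordinate \<open>r\<close> is a target
  value for \<open>x N\<close>. The multiplier \<open>\<mu>\<close> is raised if \<open>x N < r\<close> and lowered if
  \<open>x N > r\<close>; the target is moved in the direction \<open>\<sigma>\<close> if \<open>\<mu> > 1\<close> and in the opposite
  direction if \<open>\<mu> < 1\<close>. Both are truncated to a compact interval.
\<close>
lemma discrete_fixed_point:
  fixes F :: "nat \<Rightarrow> real \<Rightarrow> real" and b p q :: "nat \<Rightarrow> real" and v :: "nat \<Rightarrow> nat \<Rightarrow> real"
  assumes F: "\<And>j. continuous_on UNIV (F j)" "\<And>j x. \<bar>F j x\<bar> \<le> D"
    and v: "\<And>i j. i \<le> j \<Longrightarrow> v i j = 0"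
    and "0 \<le> \<epsilon>" "A \<le> B" "0 \<le> m"
  shows "\<exists>x \<mu> r.
    (\<forall>i\<le>N. x i = \<mu> * (\<epsilon> + (\<Sum>j<N. (b j + p i * q j - v i j) * F j (x j)))) \<and>
    \<mu> = max 0 (min m (\<mu> + r - x N)) \<and> r = max A (min B (r + \<sigma> * (\<mu> - 1)))"
proof -
  define R where "R = m * (\<epsilon> + (\<Sum>j<N. \<bar>b j\<bar> * D))"
  define Q where "Q = m * (\<Sum>j<N. \<bar>q j\<bar> * D)"
  define S where "S = {-R..R} \<times> {-Q..Q} \<times> {0..m} \<times> {A..B}"
  define X where "X = (\<lambda>(a, c, \<mu>, r :: real). volterra_step p v F a c \<mu>)"
  define \<Phi> where "\<Phi> = (\<lambda>z. case z of (a, c, \<mu>, r) \<Rightarrow>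
     (\<mu> * (\<epsilon> + (\<Sum>j<N. b j * F j (X z j))),
      \<mu> * (\<Sum>j<N. q j * F j (X z j)),
      max 0 (min m (\<mu> + r - X z N)),
      max A (min B (r + \<sigma> * (\<mu> - 1)))))"
  have D: "0 \<le> D" using F(2)[of 0 0] by linarith
  have RQ: "0 \<le> R" "0 \<le> Q"
    unfolding R_def Q_def using assms D by (auto intro!: mult_nonneg_nonneg add_nonneg_nonneg sum_nonneg)
  have bound: "\<bar>\<Sum>j<N. w j * F j (y j)\<bar> \<le> (\<Sum>j<N. \<bar>w j\<bar> * D)" for w y :: "nat \<Rightarrow> real"
    by (rule order_trans[OF sum_abs]) (auto intro!: sum_mono mult_left_mono F(2) simp: abs_mult)
  have "compact S" "convex S" "S \<noteq> {}"
    unfolding S_def using RQ assms by (auto intro!: compact_Times convex_Times)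
  moreover have "continuous_on S \<Phi>"
  proof -
    have X: "continuous_on S (\<lambda>z. X z j)" for j
      unfolding X_def case_prod_unfold
      by (intro continuous_volterra_step F continuous_intros)
    have FX: "continuous_on S (\<lambda>z. F j (X z j))" for j
      using continuous_on_compose2[OF F(1) X] by auto
    show ?thesis
      unfolding \<Phi>_def case_prod_unfold
      by (intro continuous_intros continuous_on_max continuous_on_min X FX)
  qed
  moreover have "\<Phi> \<in> S \<rightarrow> S"
  proof
    fix z assume "z \<in> S"
    then obtain a c \<mu> r where z: "z = (a, c, \<mu>, r)" and m: "0 \<le> \<mu>" "\<mu> \<le> m"
      unfolding S_def by auto
    have "\<bar>\<mu> * (\<epsilon> + (\<Sum>j<N. b j * F j (X z j)))\<bar> \<le> R"
      unfolding abs_mult R_def using m \<open>0 \<le> \<epsilon>\<close>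
      by (intro mult_mono order_trans[OF abs_triangle_ineq] add_mono bound) auto
    moreover have "\<bar>\<mu> * (\<Sum>j<N. q j * F j (X z j))\<bar> \<le> Q"
      unfolding abs_mult Q_def using m by (intro mult_mono bound) auto
    ultimately show "\<Phi> z \<in> S"
      unfolding \<Phi>_def S_def z using assms by (auto simp: abs_le_iff)
  qed
  ultimately obtain z where "\<Phi> z = z" by (rule brouwer)
  moreover obtain a c \<mu> r where z: "z = (a, c, \<mu>, r)" by (metis prod.exhaust)
  ultimately have eq: "a = \<mu> * (\<epsilon> + (\<Sum>j<N. b j * F j (X z j)))"
      "c = \<mu> * (\<Sum>j<N. q j * F j (X z j))"
      "\<mu> = max 0 (min m (\<mu> + r - X z N))"
      "r = max A (min B (r + \<sigma> * (\<mu> - 1)))"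
    unfolding \<Phi>_def z by auto
  have "X z i = \<mu> * (\<epsilon> + (\<Sum>j<N. (b j + p i * q j - v i j) * F j (X z j)))" if "i \<le> N" for i
  proof -
    have "(\<Sum>j<i. v i j * F j (X z j)) = (\<Sum>j<N. v i j * F j (X z j))"
      by (rule sum.mono_neutral_left) (use that v in auto)
    moreover have "X z = volterra_step p v F a c \<mu>" by (simp add: X_def z)
    ultimately have "X z i = a + c * p i - \<mu> * (\<Sum>j<N. v i j * F j (X z j))"
      using volterra_step.simps[of p v F a c \<mu> i] by simp
    then show ?thesis
      unfolding eq(1,2) by (simp add: algebra_simps sum.distrib sum_subtractf sum_distrib_left)
  qed
  with eq(3,4) show ?thesis by blast
qed

text \<open>
  Krasnoselskii's theorem on compression and expansion for the annulus \<open>A \<le> x N \<le> B\<close>, with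
  \<open>\<sigma> = 1\<close> if \<open>T\<close> compresses at \<open>A\<close> and expands at \<open>B\<close>, and \<open>\<sigma> = -1\<close> in the opposite case.
  In the fixed point of the previous lemma \<open>\<mu>\<close> is not extremal: \<open>\<mu> = 0\<close> gives \<open>x N = 0 < r\<close>,
  and a large \<open>\<mu>\<close> gives \<open>x N > r\<close> because \<open>T \<epsilon> N x N \<ge> \<epsilon> > 0\<close>. Hence \<open>x N = r\<close>. If \<open>\<mu> \<noteq> 1\<close>, then \<open>r\<close> has been pushed to the
  end of \<open>[A, B]\<close> at which the assumed behaviour of \<open>T\<close> gives the opposite sign of \<open>\<mu> - 1\<close>.
\<close>
lemma discrete_annulus_fixed_point:
  fixes F :: "nat \<Rightarrow> real \<Rightarrow> real" and b p q :: "nat \<Rightarrow> real" and v :: "nat \<Rightarrow> nat \<Rightarrow> real"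
  defines "T \<equiv> \<lambda>\<epsilon> N x i. \<epsilon> + (\<Sum>j<N. (b j + p i * q j - v i j) * F j (x j))"
  assumes F: "\<And>j. continuous_on UNIV (F j)" "\<And>j x. \<bar>F j x\<bar> \<le> D"
    and v: "\<And>i j. i \<le> j \<Longrightarrow> v i j = 0"
    and pos: "\<And>x. T 0 N x N \<ge> 0"
    and "0 < \<epsilon>" "0 < A" "A \<le> B"
    and \<sigma>: "\<sigma> = 1 \<or> \<sigma> = -1"
    and A: "\<And>x \<mu>. 0 < \<mu> \<Longrightarrow> \<forall>i\<le>N. x i = \<mu> * T \<epsilon> N x i \<Longrightarrow> x N = A \<Longrightarrow> \<sigma> * (T \<epsilon> N x N - A) < 0"
    and B: "\<And>x \<mu>. 0 < \<mu> \<Longrightarrow> \<forall>i\<le>N. x i = \<mu> * T \<epsilon> N x i \<Longrightarrow> x N = B \<Longrightarrow> \<sigma> * (T \<epsilon> N x N - B) > 0"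
  shows "\<exists>x. (\<forall>i\<le>N. x i = T \<epsilon> N x i) \<and> A \<le> x N \<and> x N \<le> B"
proof -
  \<comment> \<open>with \<open>\<mu> = m\<close> the value \<open>x N \<ge> m * \<epsilon>\<close> would exceed every target \<open>r \<le> B\<close>\<close>
  define m where "m = (B + 1) / \<epsilon>"
  have m: "0 < m" using assms by (simp add: m_def)
  have "\<exists>x \<mu> r.
    (\<forall>i\<le>N. x i = \<mu> * T \<epsilon> N x i) \<and>
    \<mu> = max 0 (min m (\<mu> + r - x N)) \<and> r = max A (min B (r + \<sigma> * (\<mu> - 1)))"
    unfolding T_def by (rule discrete_fixed_point) (use F v \<open>0 < \<epsilon>\<close> \<open>A \<le> B\<close> m in auto)
  then obtain x \<mu> r where
    x: "\<forall>i\<le>N. x i = \<mu> * T \<epsilon> N x i" and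
    \<mu>: "\<mu> = max 0 (min m (\<mu> + r - x N))" and
    r: "r = max A (min B (r + \<sigma> * (\<mu> - 1)))"
    by blast
  define S where "S = T \<epsilon> N x N"
  have xN: "x N = \<mu> * S" using x by (simp add: S_def)
  have rAB: "A \<le> r" "r \<le> B" using r \<open>A \<le> B\<close> by auto
  have S: "\<epsilon> \<le> S" using pos[of x] by (simp add: T_def S_def)
  with \<open>0 < \<epsilon>\<close> have "0 < S" by linarith
  have "\<mu> \<noteq> 0"
  proof
    assume "\<mu> = 0"
    with xN \<mu> m rAB \<open>0 < A\<close> show False by simp
  qed
  with \<mu> m have \<mu>0: "0 < \<mu>" by linarith
  have "\<mu> \<noteq> m"
  proof
    assume *: "\<mu> = m"
    have "m * \<epsilon> \<le> x N" unfolding xN * using S m by (intro mult_left_mono) auto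
    moreover have "m * \<epsilon> = B + 1" using \<open>0 < \<epsilon>\<close> by (simp add: m_def)
    ultimately show False using \<mu> * rAB m by linarith
  qed
  with \<mu> \<mu>0 have xr: "x N = r" by linarith
  have "\<mu> = 1"
  proof (rule ccontr)
    assume "\<mu> \<noteq> 1"
    then consider "1 < \<mu>" "S < \<mu> * S" | "\<mu> < 1" "\<mu> * S < S"
      using \<open>0 < S\<close> by (cases "\<mu> < 1") auto
    then show False
    proof cases
      case 1
      show False using \<sigma>
      proof
        assume "\<sigma> = 1"
        with 1 r rAB have "r = B" by simp
        then show False using B[OF \<mu>0 x] \<open>\<sigma> = 1\<close> xN xr 1 by (simp add: S_def)
      next
        assume "\<sigma> = -1"
        with 1 r rAB have "r = A" by simp
        then show False using A[OF \<mu>0 x] \<open>\<sigma> = -1\<close> xN xr 1 by (simp add: S_def)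
      qed
    next
      case 2
      show False using \<sigma>
      proof
        assume "\<sigma> = 1"
        with 2 r rAB have "r = A" by simp
        then show False using A[OF \<mu>0 x] \<open>\<sigma> = 1\<close> xN xr 2 by (simp add: S_def)
      next
        assume "\<sigma> = -1"
        with 2 r rAB have "r = B" by simp
        then show False using B[OF \<mu>0 x] \<open>\<sigma> = -1\<close> xN xr 2 by (simp add: S_def)
      qed
    qed
  qed
  with x xr rAB show ?thesis by (intro exI[of _ x]) simp
qed

section \<open>Riemann sums of uniformly convergent functions\<close>

text \<open>
  On a mesh cell the value at the left node differs from the mean of \<open>g\<close> by the error of the
  uniform approximation plus the oscillation of \<open>g\<close>; the primitive of \<open>g\<close> telescopes.
\<close>
lemma riemann_sum_uniform_limit:
  fixes g :: "real \<Rightarrow> real"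
  assumes g: "continuous_on {0..1} g"
    and lim: "uniform_limit {0..1} G g sequentially"
    and N: "filterlim N at_top sequentially"
  shows "(\<lambda>n. (\<Sum>j<N n. G n (real j / real (N n))) / real (N n)) \<longlonglongrightarrow> integral {0..1} g"
proof (rule LIMSEQ_I)
  fix e :: real assume "0 < e"
  obtain d where d: "0 < d" "\<And>s t. s \<in> {0..1} \<Longrightarrow> t \<in> {0..1} \<Longrightarrow> \<bar>t - s\<bar> < d \<Longrightarrow> \<bar>g t - g s\<bar> < e/3"
    using compact_uniformly_continuous[OF g] \<open>0 < e\<close>
    unfolding uniformly_continuous_on_def dist_real_def
    by (metis compact_Icc divide_pos_pos zero_less_numeral)
  have "\<forall>\<^sub>F n in sequentially. \<forall>s\<in>{0..1}. dist (G n s) (g s) < e/3"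
    using uniform_limitD[OF lim, of "e/3"] \<open>0 < e\<close> by simp
  moreover have "\<forall>\<^sub>F n in sequentially. N n \<ge> nat \<lceil>1/d\<rceil> + 1"
    using N by (auto simp: filterlim_at_top)
  ultimately have "\<forall>\<^sub>F n in sequentially.
     norm ((\<Sum>j<N n. G n (real j / real (N n))) / real (N n) - integral {0..1} g) < e"
  proof eventually_elim
    case (elim n)
    define M where "M = real (N n)"
    define t where "t = (\<lambda>j::nat. real j / M)"
    have M: "M > 1 / d" "M > 0" using elim(2) \<open>0 < d\<close> unfolding M_def by linarith+
    then have h: "1 / M < d" using \<open>0 < d\<close> by (simp add: field_simps)
    define P where "P = (\<lambda>x. integral {0..x} g)"
    have gi: "g integrable_on {x..y}" if "0 \<le> x" "y \<le> 1" for x y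
      by (rule integrable_continuous_real) (rule continuous_on_subset[OF g], use that in auto)
    have step: "\<bar>G n (t j) / M - (P (t (Suc j)) - P (t j))\<bar> \<le> (2*e/3) / M" if "j < N n" for j
    proof -
      have tj: "0 \<le> t j" "t j \<le> t (Suc j)" "t (Suc j) \<le> 1" "t (Suc j) - t j = 1/M"
        using that M unfolding t_def by (auto simp: M_def field_simps)
      have "P (t (Suc j)) = P (t j) + integral {t j..t (Suc j)} g"
        unfolding P_def by (rule Henstock_Kurzweil_Integration.integral_combine[symmetric]) (use tj gi in auto)
      moreover have "integral {t j..t (Suc j)} (\<lambda>s. G n (t j) - g s) = G n (t j) / M - integral {t j..t (Suc j)} g"
        using tj by (subst integral_diff) (auto intro!: gi)
      moreover have "norm (integral {t j..t (Suc j)} (\<lambda>s. G n (t j) - g s)) \<le> (2*e/3) * (t (Suc j) - t j)"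
      proof (rule integral_bound)
        show "t j \<le> t (Suc j)" by fact
        show "continuous_on {t j..t (Suc j)} (\<lambda>s. G n (t j) - g s)"
          by (intro continuous_intros continuous_on_subset[OF g]) (use tj in auto)
        fix s assume s: "s \<in> {t j..t (Suc j)}"
        have "\<bar>G n (t j) - g (t j)\<bar> < e/3" using elim(1) tj by (auto simp: dist_real_def)
        moreover have "\<bar>g (t j) - g s\<bar> < e/3"
          using s tj h by (intro d) auto
        ultimately show "norm (G n (t j) - g s) \<le> 2*e/3" unfolding real_norm_def by linarith
      qed
      ultimately show ?thesis using tj(4) by auto
    qed
    have "(\<Sum>j<N n. P (t (Suc j)) - P (t j)) = P (t (N n)) - P (t 0)" by (rule sum_lessThan_telescope)
    also have "\<dots> = integral {0..1} g" using M unfolding P_def t_def M_def by simp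
    finally have "(\<Sum>j<N n. G n (t j)) / M - integral {0..1} g
        = (\<Sum>j<N n. G n (t j) / M - (P (t (Suc j)) - P (t j)))"
      by (simp add: sum_subtractf sum_divide_distrib)
    also have "\<bar>\<dots>\<bar> \<le> (\<Sum>j<N n. (2*e/3) / M)"
      by (rule order_trans[OF sum_abs]) (intro sum_mono step, simp)
    also have "\<dots> = 2*e/3" using M by (simp add: M_def)
    finally show ?case using \<open>0 < e\<close> by (simp add: t_def M_def)
  qed
  then show "\<exists>no. \<forall>n\<ge>no. norm ((\<Sum>j<N n. G n (real j / real (N n))) / real (N n) - integral {0..1} g) < e"
    by (simp add: eventually_sequentially)
qed

section \<open>Green's function\<close>

text \<open>
  The function \<open>w(t) = \<integral> green t s * h s ds\<close> has fourth derivative \<open>- h\<close> and satisfies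
  \<open>w(0) = Dw(0) = D\<^sup>2w(0) = Dw(1) = 0\<close>: integrate four times from \<open>0\<close> and choose the free third
  derivative at \<open>0\<close> so that \<open>Dw(1) = 0\<close>.
\<close>
definition green :: "real \<Rightarrow> real \<Rightarrow> real" where
  "green t s = (t^3 * (1 - s)^2 - (max 0 (t - s))^3) / 6"

lemma six_green: "6 * green t s = t^3 * (1 - s)^2 - (max 0 (t - s))^3"
  by (simp add: green_def)

lemma green_0: "0 \<le> s \<Longrightarrow> green 0 s = 0"
  by (simp add: green_def)

lemma green_1: "s \<le> 1 \<Longrightarrow> green 1 s = s * (1 - s)^2 / 6"
  by (simp add: green_def power2_eq_square power3_eq_cube algebra_simps)

lemma max_diff_le_mult:
  fixes t s :: real
  assumes "0 \<le> t" "t \<le> 1" "0 \<le> s" "s \<le> 1"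
  shows "max 0 (t - s) \<le> t * (1 - s)"
proof -
  have "t * s \<le> 1 * s" using assms by (intro mult_right_mono) auto
  moreover have "0 \<le> t * (1 - s)" using assms by simp
  ultimately show ?thesis by (simp add: algebra_simps)
qed

lemma cube_diff: "a^3 - b^3 = (a - b) * (a^2 + a * b + b^2)" for a b :: real
  by (simp add: power2_eq_square power3_eq_cube algebra_simps)

text \<open>
  Factor the differences of cubes; each factor of \<open>a\<^sup>3 - b\<^sup>3\<close> is controlled by
  \<open>max 0 (t - s) \<le> t * (1 - s)\<close>. Monotonicity makes the norm of a solution its value at \<open>1\<close>.
\<close>
lemma green_mono:
  assumes "0 \<le> t" "t \<le> t'" "t' \<le> 1" "0 \<le> s" "s \<le> 1"
  shows "green t s \<le> green t' s"
proof -
  define a b where "a = max 0 (t' - s)" and "b = max 0 (t - s)"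
  have ab: "0 \<le> b" "b \<le> a" "a - b \<le> t' - t" "a \<le> t' * (1 - s)" "b \<le> t * (1 - s)"
    unfolding a_def b_def using assms max_diff_le_mult[of t' s] max_diff_le_mult[of t s] by auto
  have "a^3 - b^3 \<le> (t' - t) * ((t' * (1 - s))^2 + (t' * (1 - s)) * (t * (1 - s)) + (t * (1 - s))^2)"
    unfolding cube_diff using ab by (intro mult_mono add_mono power_mono) auto
  also have "\<dots> = (t'^3 - t^3) * (1 - s)^2"
    by (simp add: power2_eq_square power3_eq_cube algebra_simps)
  finally have "a^3 - b^3 \<le> (t'^3 - t^3) * (1 - s)^2" .
  moreover have "6 * green t' s - 6 * green t s = (t'^3 - t^3) * (1 - s)^2 - (a^3 - b^3)"
    unfolding six_green a_def b_def by (simp add: left_diff_distrib)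
  ultimately show ?thesis by linarith
qed

text \<open>
  The subtracted cube is nondecreasing in \<open>t\<close>, so the increment is at most that of
  \<open>t\<^sup>3 * (1 - s)\<^sup>2 / 6\<close>.
\<close>
lemma green_lipschitz:
  assumes "0 \<le> t" "t \<le> t'" "t' \<le> 1" "0 \<le> s" "s \<le> 1"
  shows "green t' s - green t s \<le> t' - t"
proof -
  have "(max 0 (t - s))^3 \<le> (max 0 (t' - s))^3" using assms by (intro power_mono) auto
  moreover have "6 * green t' s - 6 * green t s
      = (t'^3 - t^3) * (1 - s)^2 - ((max 0 (t' - s))^3 - (max 0 (t - s))^3)"
    unfolding six_green by (simp add: left_diff_distrib)
  ultimately have "green t' s - green t s \<le> (t'^3 - t^3) * (1 - s)^2 / 6"
    by linarith
  also have "\<dots> \<le> (t'^3 - t^3) * 1 / 6"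
    using assms by (intro divide_right_mono mult_left_mono power_le_one) (auto intro!: power_mono)
  also have "\<dots> \<le> (t' - t) * 3 / 6"
  proof -
    have "t'^2 \<le> 1" "t^2 \<le> 1" "t' * t \<le> 1" using assms by (auto intro!: power_le_one mult_le_one)
    then have "(t' - t) * (t'^2 + t' * t + t^2) \<le> (t' - t) * 3" using assms by (intro mult_left_mono) auto
    then show ?thesis by (simp add: cube_diff)
  qed
  finally show ?thesis using assms by simp
qed

text \<open>
  This bound puts all functions \<open>\<integral> green t s * h s ds\<close> with \<open>h \<ge> 0\<close> into the cone of functions
  \<open>u\<close> with \<open>u t \<ge> t\<^sup>3 * u 1\<close>.
\<close>
lemma green_ge_cube:
  assumes "0 \<le> t" "t \<le> 1" "0 \<le> s" "s \<le> 1"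
  shows "t^3 * green 1 s \<le> green t s"
proof -
  have "(max 0 (t - s))^3 \<le> (t * (1 - s))^3"
    using max_diff_le_mult[OF assms] by (intro power_mono) auto
  moreover have "t^3 * green 1 s = (t^3 * (1 - s)^2 - (t * (1 - s))^3) / 6"
    using assms by (simp add: green_def power_mult_distrib[of t "1 - s"] right_diff_distrib[of "t^3"])
  ultimately show ?thesis by (simp add: green_def)
qed

lemma green_nonneg: "\<lbrakk>0 \<le> t; t \<le> 1; 0 \<le> s; s \<le> 1\<rbrakk> \<Longrightarrow> 0 \<le> green t s"
  using green_mono[of 0 t s] by (simp add: green_0)

lemma green_1_le: "\<lbrakk>0 \<le> s; s \<le> 1\<rbrakk> \<Longrightarrow> green 1 s \<le> 1 / 24"
proof -
  assume s: "0 \<le> s" "s \<le> 1"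
  have "0 \<le> (1 - 2 * s)^2" by simp
  then have "s * (1 - s) \<le> 1/4" by (simp add: power2_eq_square algebra_simps)
  then have "(s * (1 - s)) * (1 - s) \<le> (1/4) * 1" using s by (intro mult_mono) auto
  then show ?thesis using s by (simp add: green_1 power2_eq_square algebra_simps)
qed

lemma green_1_ge:
  assumes "1/4 \<le> s" "s \<le> 3/4"
  shows "1/384 \<le> green 1 s"
proof -
  define P where "P = s * (1 - s)^2"
  have "(1/4) * (1/4)^2 \<le> P" unfolding P_def using assms by (intro mult_mono power_mono) auto
  moreover have "(1/4) * (1/4)^2 = (1/64 :: real)" by (simp add: power2_eq_square)
  moreover have "green 1 s = P / 6" unfolding P_def by (rule green_1) (use assms in linarith)
  ultimately show ?thesis by linarith
qed

lemma continuous_green: "continuous_on S (\<lambda>t. green t s)" "continuous_on S (\<lambda>s. green t s)"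
  unfolding green_def by (intro continuous_intros continuous_on_max; simp)+

section \<open>The nonlocal problem and its quadrature approximation\<close>

locale nonlocal_bvp =
  fixes f :: "real \<Rightarrow> real \<Rightarrow> real" and \<alpha> k :: real and n :: nat and \<beta> \<eta> :: "nat \<Rightarrow> real"
  assumes f_continuous: "continuous_on ({0..1} \<times> {0..}) (\<lambda>(t, u). f t u)"
    and f_nonneg: "\<lbrakk>t \<in> {0..1}; 0 \<le> u\<rbrakk> \<Longrightarrow> 0 \<le> f t u"
    and \<alpha>_nonneg: "0 \<le> \<alpha>"
    and \<beta>_nonneg: "i \<in> {1..n} \<Longrightarrow> 0 \<le> \<beta> i"
    and \<eta>_bounds: "i \<in> {1..n} \<Longrightarrow> \<eta> i \<in> {0<..<1}"
    and k_eq: "k = 1 - (\<alpha> + (\<Sum>i=1..n. \<beta> i))"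
    and k_pos: "0 < k"
begin

lemma nonlocal_functional_le:
  assumes "continuous_on {0..1} w" "\<And>t. t \<in> {0..1} \<Longrightarrow> w t \<le> c"
  shows "\<alpha> * integral {0..1} w + (\<Sum>i=1..n. \<beta> i * w (\<eta> i)) \<le> (1 - k) * c"
proof -
  have "integral {0..1} w \<le> integral {0..1::real} (\<lambda>_. c)"
    using assms by (intro integral_le integrable_continuous_real) auto
  then have "\<alpha> * integral {0..1} w \<le> \<alpha> * c"
    using \<alpha>_nonneg by (intro mult_left_mono) auto
  moreover have "(\<Sum>i=1..n. \<beta> i * w (\<eta> i)) \<le> (\<Sum>i=1..n. \<beta> i * c)"
    using \<beta>_nonneg \<eta>_bounds by (intro sum_mono mult_left_mono assms(2)) force+
  moreover have "(1 - k) * c = \<alpha> * c + (\<Sum>i=1..n. \<beta> i * c)"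
    by (simp add: k_eq sum_distrib_right distrib_right)
  ultimately show ?thesis by linarith
qed

text \<open>
  For \<open>u(t) = u(0) + \<integral> green t s * h s ds\<close> the nonlocal condition is a scalar equation for
  \<open>u(0)\<close>, with solution \<open>\<integral> boundary_weight s * h s ds\<close>. So the full kernel of the problem is
  \<open>boundary_weight s + green t s\<close>.
\<close>
definition boundary_weight :: "real \<Rightarrow> real" where
  "boundary_weight s =
     (\<alpha> * integral {0..1} (\<lambda>t. green t s) + (\<Sum>i=1..n. \<beta> i * green (\<eta> i) s)) / k"

lemma boundary_weight_nonneg:
  assumes "0 \<le> s" "s \<le> 1"
  shows "0 \<le> boundary_weight s"
proof -
  have "0 \<le> integral {0..1} (\<lambda>t. green t s)"
    using assms by (intro integral_nonneg integrable_continuous_real continuous_green) (auto intro: green_nonneg)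
  moreover have "0 \<le> (\<Sum>i=1..n. \<beta> i * green (\<eta> i) s)"
    using assms \<beta>_nonneg \<eta>_bounds by (intro sum_nonneg mult_nonneg_nonneg green_nonneg) force+
  ultimately show ?thesis using \<alpha>_nonneg k_pos by (simp add: boundary_weight_def)
qed

lemma boundary_weight_le:
  assumes "0 \<le> s" "s \<le> 1"
  shows "boundary_weight s + green 1 s \<le> green 1 s / k"
proof -
  have "k * boundary_weight s \<le> (1 - k) * green 1 s"
    using nonlocal_functional_le[of "\<lambda>t. green t s" "green 1 s"] assms k_pos
    by (auto simp: boundary_weight_def intro: continuous_green green_mono)
  then have "boundary_weight s * k + green 1 s * k \<le> green 1 s" by (simp add: algebra_simps)
  then show ?thesis using k_pos by (simp add: field_simps)
qed

text \<open>
  The integral operator is replaced by its left Riemann sum. The summand \<open>\<epsilon>\<close> keeps its values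
  away from \<open>0\<close>, which excludes the trivial fixed point when \<open>f\<close> vanishes at \<open>u = 0\<close>.
\<close>
definition quadrature :: "real \<Rightarrow> nat \<Rightarrow> (real \<Rightarrow> real) \<Rightarrow> real \<Rightarrow> real" where
  "quadrature \<epsilon> N h t = \<epsilon> + (\<Sum>j<N. (boundary_weight (real j / real N) + green t (real j / real N)) * h (real j / real N)) / N"

lemma node_bounds: "j < N \<Longrightarrow> 0 \<le> real j / real N" "j < N \<Longrightarrow> real j / real N \<le> 1"
  by auto

context
  fixes \<epsilon> :: real and N :: nat and h :: "real \<Rightarrow> real"
  assumes \<epsilon>: "0 \<le> \<epsilon>" and h: "\<And>s. s \<in> {0..1} \<Longrightarrow> 0 \<le> h s"
begin

lemma quadrature_mono:
  assumes "0 \<le> t" "t \<le> t'" "t' \<le> 1"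
  shows "quadrature \<epsilon> N h t \<le> quadrature \<epsilon> N h t'"
  unfolding quadrature_def using assms h node_bounds
  by (intro add_left_mono divide_right_mono sum_mono mult_right_mono green_mono) auto

lemma quadrature_ge:
  assumes "0 \<le> t" "t \<le> 1"
  shows "\<epsilon> \<le> quadrature \<epsilon> N h t"
proof -
  have "0 \<le> (\<Sum>j<N. (boundary_weight (real j / real N) + green t (real j / real N)) * h (real j / real N)) / N"
    using assms h node_bounds
    by (intro divide_nonneg_nonneg sum_nonneg mult_nonneg_nonneg add_nonneg_nonneg
        boundary_weight_nonneg green_nonneg) auto
  then show ?thesis by (simp add: quadrature_def)
qed

lemma quadrature_ge_cube:
  assumes "0 \<le> t" "t \<le> 1"
  shows "t^3 * quadrature \<epsilon> N h 1 \<le> quadrature \<epsilon> N h t"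
proof -
  have t3: "t^3 \<le> 1" using assms by (simp add: power_le_one)
  have "t^3 * ((boundary_weight (real j / real N) + green 1 (real j / real N)) * h (real j / real N))
      \<le> (boundary_weight (real j / real N) + green t (real j / real N)) * h (real j / real N)" if j: "j < N" for j
  proof -
    have "t^3 * boundary_weight (real j / real N) \<le> 1 * boundary_weight (real j / real N)"
      using t3 node_bounds[OF j] by (intro mult_right_mono boundary_weight_nonneg) auto
    moreover have "t^3 * green 1 (real j / real N) \<le> green t (real j / real N)"
      using assms node_bounds[OF j] by (intro green_ge_cube) auto
    ultimately have "(t^3 * (boundary_weight (real j / real N) + green 1 (real j / real N))) * h (real j / real N)
        \<le> (boundary_weight (real j / real N) + green t (real j / real N)) * h (real j / real N)"
      using h node_bounds[OF j] by (intro mult_right_mono) (auto simp: distrib_left)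
    then show ?thesis by (simp add: mult.assoc)
  qed
  then have "(\<Sum>j<N. t^3 * ((boundary_weight (real j / real N) + green 1 (real j / real N)) * h (real j / real N)))
      \<le> (\<Sum>j<N. (boundary_weight (real j / real N) + green t (real j / real N)) * h (real j / real N))" (is "?a \<le> ?b")
    by (intro sum_mono) auto
  then have "?a / N \<le> ?b / N" by (rule divide_right_mono) simp
  moreover have "t^3 * \<epsilon> \<le> 1 * \<epsilon>" using t3 \<epsilon> by (rule mult_right_mono)
  ultimately show ?thesis
    by (simp add: quadrature_def distrib_left sum_distrib_left[symmetric])
qed

lemma quadrature_lipschitz:
  assumes t: "0 \<le> t" "t \<le> t'" "t' \<le> 1" and D: "\<And>s. s \<in> {0..1} \<Longrightarrow> h s \<le> D" and N: "0 < N"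
  shows "quadrature \<epsilon> N h t' - quadrature \<epsilon> N h t \<le> D * (t' - t)"
proof -
  have "(green t' (real j / real N) - green t (real j / real N)) * h (real j / real N) \<le> (t' - t) * D" if "j < N" for j
    using t h[of "real j / real N"] D[of "real j / real N"] node_bounds[OF that]
    by (intro mult_mono green_lipschitz) auto
  then have "(\<Sum>j<N. (green t' (real j / real N) - green t (real j / real N)) * h (real j / real N)) \<le> (\<Sum>j<N. (t' - t) * D)"
    by (intro sum_mono) auto
  then have "(\<Sum>j<N. (green t' (real j / real N) - green t (real j / real N)) * h (real j / real N)) / N \<le> (t' - t) * D"
    using N by (simp add: divide_le_eq mult.commute)
  then show ?thesis
    by (simp add: quadrature_def diff_divide_distrib[symmetric] sum_subtractf[symmetric] algebra_simps)
qed

end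

text \<open>
  The nonlocal condition survives discretisation exactly, up to \<open>k * \<epsilon>\<close>: the sum over the nodes
  is finite and can be integrated in \<open>t\<close> term by term. Thus the condition passes to the limit
  without an exchange of two integrals.
\<close>
lemma quadrature_boundary:
  "quadrature \<epsilon> N h 0 = k * \<epsilon> + \<alpha> * integral {0..1} (quadrature \<epsilon> N h)
     + (\<Sum>i=1..n. \<beta> i * quadrature \<epsilon> N h (\<eta> i))"
proof -
  define a where "a = quadrature \<epsilon> N h 0"
  define c where "c = (\<lambda>j. h (real j / real N) / real N)"
  have a: "a = \<epsilon> + (\<Sum>j<N. boundary_weight (real j / real N) * c j)"
    unfolding a_def quadrature_def c_def by (auto simp: green_0 sum_divide_distrib intro!: sum.cong)
  have q: "quadrature \<epsilon> N h = (\<lambda>t. a + (\<Sum>j<N. green t (real j / real N) * c j))"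
    by (rule ext) (simp add: a quadrature_def c_def distrib_right sum.distrib add_divide_distrib sum_divide_distrib)
  have int: "integral {0..1} (quadrature \<epsilon> N h)
      = a + (\<Sum>j<N. integral {0..1} (\<lambda>t. green t (real j / real N)) * c j)"
  proof -
    have i: "(\<lambda>t. green t (real j / real N) * c j) integrable_on {0..1}" for j
      by (intro integrable_continuous_real continuous_intros continuous_green)
    have "integral {0..1} (quadrature \<epsilon> N h)
        = a + integral {0..1} (\<lambda>t. \<Sum>j<N. green t (real j / real N) * c j)"
      unfolding q by (subst integral_add) (auto intro!: integrable_sum i)
    also have "integral {0..1} (\<lambda>t. \<Sum>j<N. green t (real j / real N) * c j)
        = (\<Sum>j<N. integral {0..1} (\<lambda>t. green t (real j / real N)) * c j)"
      by (subst integral_sum) (auto intro: i)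
    finally show ?thesis .
  qed
  have "k * (a - \<epsilon>) = (\<Sum>j<N. k * boundary_weight (real j / real N) * c j)"
    by (simp add: a sum_distrib_left mult.assoc)
  also have "\<dots> = (\<Sum>j<N. \<alpha> * (integral {0..1} (\<lambda>t. green t (real j / real N)) * c j)
      + (\<Sum>i=1..n. \<beta> i * (green (\<eta> i) (real j / real N) * c j)))"
    using k_pos by (intro sum.cong refl) (simp add: boundary_weight_def distrib_right sum_distrib_right mult.assoc)
  also have "\<dots> = \<alpha> * (\<Sum>j<N. integral {0..1} (\<lambda>t. green t (real j / real N)) * c j)
      + (\<Sum>i=1..n. \<beta> i * (\<Sum>j<N. green (\<eta> i) (real j / real N) * c j))"
    by (simp add: sum.distrib sum_distrib_left sum.swap[of _ "{..<N}"])
  also have "\<dots> = \<alpha> * (integral {0..1} (quadrature \<epsilon> N h) - a)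
      + (\<Sum>i=1..n. \<beta> i * (quadrature \<epsilon> N h (\<eta> i) - a))"
    unfolding int by (simp add: q)
  also have "\<dots> = \<alpha> * integral {0..1} (quadrature \<epsilon> N h)
      + (\<Sum>i=1..n. \<beta> i * quadrature \<epsilon> N h (\<eta> i)) - (1 - k) * a"
    by (simp add: k_eq algebra_simps sum_subtractf sum_distrib_left)
  finally show ?thesis by (simp add: a_def algebra_simps)
qed

text \<open>
  The two conditions on \<open>f\<close> that force the operator to decrease or to increase the norm of the
  functions of the cone with norm \<open>r\<close>. On \<open>[1/4, 3/4]\<close> such functions take values in
  \<open>[r/64, r]\<close>. The slope \<open>100000\<close> is any number larger than \<open>2 * 384 * 64\<close>: half of the nodes
  lie in \<open>[1/4, 3/4]\<close>, where \<open>green 1 \<ge> 1/384\<close>.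
\<close>
definition compressing :: "real \<Rightarrow> bool" where
  "compressing r \<longleftrightarrow> (\<forall>t\<in>{0..1}. \<forall>x\<in>{0..r}. f t x \<le> 6 * k * r)"

definition expanding :: "real \<Rightarrow> bool" where
  "expanding r \<longleftrightarrow> (\<forall>t\<in>{0..1}. \<forall>x\<in>{r/64..r}. 100000 * x \<le> f t x)"

text \<open>
  The full kernel at \<open>t = 1\<close> is at most \<open>1 / (24 * k)\<close>, so the bound \<open>6 * k * r\<close> on \<open>f\<close> leaves a
  factor \<open>4\<close> to spare. This is what makes the inequalities with \<open>\<rho>\<^sub>1\<close> strict.
\<close>
lemma quadrature_compressing:
  assumes "compressing r" "0 < N" "\<And>s. s \<in> {0..1} \<Longrightarrow> u s \<in> {0..r}"
  shows "quadrature \<epsilon> N (\<lambda>s. f s (u s)) 1 \<le> \<epsilon> + r / 4"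
proof -
  have "(boundary_weight (real j / real N) + green 1 (real j / real N)) * f (real j / real N) (u (real j / real N)) \<le> r / 4" if "j < N" for j
  proof -
    let ?s = "real j / real N"
    have s: "0 \<le> ?s" "?s \<le> 1" using node_bounds[OF that] by auto
    have r: "0 \<le> r" using assms(3)[of 0] by auto
    have "(boundary_weight ?s + green 1 ?s) \<le> (1 / 24) / k"
      using boundary_weight_le[OF s] green_1_le[OF s] k_pos
      by (meson divide_right_mono less_imp_le order_trans)
    moreover have "f ?s (u ?s) \<le> 6 * k * r" "0 \<le> f ?s (u ?s)"
      using assms(1,3) s f_nonneg by (auto simp: compressing_def)
    ultimately have "(boundary_weight ?s + green 1 ?s) * f ?s (u ?s) \<le> ((1 / 24) / k) * (6 * k * r)"
      using k_pos by (intro mult_mono) auto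
    then show ?thesis using k_pos by simp
  qed
  then have "(\<Sum>j<N. (boundary_weight (real j / real N) + green 1 (real j / real N)) * f (real j / real N) (u (real j / real N))) \<le> (\<Sum>j<N. r / 4)"
    by (intro sum_mono) auto
  then show ?thesis using \<open>0 < N\<close> by (simp add: quadrature_def field_simps)
qed

text \<open>
  The number of nodes is a multiple of \<open>4\<close> so that the nodes with index from \<open>m\<close> to \<open>3 * m - 1\<close>,
  half of all, lie in \<open>[1/4, 3/4]\<close>.
\<close>
lemma quadrature_expanding:
  assumes "expanding r" "0 < r" "0 < m" "0 \<le> \<epsilon>"
    and u: "\<And>s. s \<in> {0..1} \<Longrightarrow> u s \<in> {s^3 * r..r}"
  shows "r < quadrature \<epsilon> (4 * m) (\<lambda>s. f s (u s)) 1"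
proof -
  define N where "N = 4 * m"
  let ?c = "\<lambda>j::nat. (boundary_weight (real j / real N) + green 1 (real j / real N)) * f (real j / real N) (u (real j / real N))"
  have nonneg: "0 \<le> ?c j" if "j < N" for j
  proof -
    have s: "0 \<le> real j / real N" "real j / real N \<le> 1" using node_bounds[OF that] by auto
    moreover have "0 \<le> (real j / real N)^3 * r" using \<open>0 < r\<close> by simp
    then have "0 \<le> u (real j / real N)"
      using u[of "real j / real N"] s by auto
    ultimately show ?thesis
      by (intro mult_nonneg_nonneg add_nonneg_nonneg boundary_weight_nonneg green_nonneg f_nonneg) auto
  qed
  \<comment> \<open>\<open>100000 / (384 * 64) > 4\<close>, and half of the nodes contribute\<close>
  have big: "4 * r \<le> ?c j" if "j \<in> {m..<3*m}" for j
  proof -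
    let ?s = "real j / real N"
    have s: "1/4 \<le> ?s" "?s \<le> 3/4" using that \<open>0 < m\<close> by (auto simp: N_def field_simps)
    have "1/384 \<le> green 1 ?s" using s by (rule green_1_ge)
    then have 1: "1/384 \<le> boundary_weight ?s + green 1 ?s"
      using boundary_weight_nonneg[of ?s] s by simp
    have s01: "?s \<in> {0..1}" unfolding atLeastAtMost_iff using s by linarith
    then have range: "?s^3 * r \<le> u ?s" "u ?s \<le> r" using u[of ?s] by auto
    have "(1/4)^3 * r \<le> ?s^3 * r" using s \<open>0 < r\<close> by (intro mult_right_mono power_mono) auto
    also note range(1)
    finally have ur: "r/64 \<le> u ?s" "u ?s \<le> r" using range(2) by (simp_all add: power3_eq_cube)
    then have "100000 * u ?s \<le> f ?s (u ?s)"
      using assms(1)[unfolded expanding_def, rule_format, OF s01, of "u ?s"] by simp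
    with ur(1) have 2: "100000 * (r/64) \<le> f ?s (u ?s)" by linarith
    have "(1/384) * (100000 * (r/64)) \<le> ?c j"
      using 1 2 \<open>0 < r\<close> by (intro mult_mono) auto
    then show ?thesis using \<open>0 < r\<close> by simp
  qed
  have "r * N < real (card {m..<3*m}) * (4 * r)" using \<open>0 < m\<close> \<open>0 < r\<close> by (simp add: N_def)
  also have "\<dots> \<le> (\<Sum>j\<in>{m..<3*m}. ?c j)" using sum_bounded_below[of "{m..<3*m}" "4*r" ?c] big by simp
  also have "\<dots> \<le> (\<Sum>j<N. ?c j)"
  proof (rule sum_mono2)
    show "{m..<3*m} \<subseteq> {..<N}" by (auto simp: N_def)
    show "0 \<le> ?c j" if "j \<in> {..<N} - {m..<3*m}" for j using that by (intro nonneg) simp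
  qed simp
  finally have "r < (\<Sum>j<N. ?c j) / N" using \<open>0 < m\<close> by (simp add: N_def field_simps)
  then show ?thesis using \<open>0 \<le> \<epsilon>\<close> by (simp add: quadrature_def N_def)
qed

section \<open>Solutions of the approximate problems\<close>

lemma continuous_f_comp:
  assumes "continuous_on {0..1} u" "\<And>t. t \<in> {0..1} \<Longrightarrow> 0 \<le> u t"
  shows "continuous_on {0..1} (\<lambda>s. f s (u s))"
proof -
  have "continuous_on {0..1} (\<lambda>s. (\<lambda>(t, x). f t x) (s, u s))"
    by (rule continuous_on_compose2[OF f_continuous])
      (use assms in \<open>force intro!: continuous_intros\<close>)+
  then show ?thesis by simp
qed

lemma f_bounded:
  obtains D where "\<And>t x. t \<in> {0..1} \<Longrightarrow> x \<in> {0..B} \<Longrightarrow> f t x \<le> D"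
proof -
  have "compact ((\<lambda>(t, x). f t x) ` ({0..1} \<times> {0..B}))"
    by (intro compact_continuous_image continuous_on_subset[OF f_continuous] compact_Times) auto
  then have "bdd_above ((\<lambda>(t, x). f t x) ` ({0..1} \<times> {0..B}))"
    by (intro bounded_imp_bdd_above compact_imp_bounded)
  then obtain D where "\<forall>z\<in>{0..1} \<times> {0..B}. (\<lambda>(t, x). f t x) z \<le> D"
    by (auto simp: bdd_above_def)
  then show thesis by (intro that[of D]) auto
qed

lemma quadrature_cong:
  "(\<And>s. s \<in> {0..1} \<Longrightarrow> h s = h' s) \<Longrightarrow> quadrature \<epsilon> N h t = quadrature \<epsilon> N h' t"
  unfolding quadrature_def using node_bounds by (auto intro!: sum.cong)

text \<open>
  The kernel of the quadrature operator has the Volterra structure required above. The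
  nonlinearity is truncated to \<open>[0, B]\<close> in order to be bounded and defined everywhere; a
  multiple \<open>\<mu> * w\<close> of a value of the operator is nondecreasing and lies in the cone, so for norm at
  most \<open>B\<close> the truncation has no effect. This gives the compression or expansion at \<open>A\<close> and \<open>B\<close>; since a compressed norm
  is at most \<open>r / 4 + \<epsilon>\<close>, the condition \<open>\<epsilon> < A / 2\<close> keeps it below \<open>r\<close>.
\<close>
lemma quadrature_fixed_point:
  assumes AB: "0 < A" "A \<le> B"
    and ends: "compressing A \<and> expanding B \<or> expanding A \<and> compressing B"
    and m: "0 < m" and \<epsilon>: "0 < \<epsilon>" "\<epsilon> < A / 2"
  shows "\<exists>u. (\<forall>t. u t = quadrature \<epsilon> (4 * m) (\<lambda>s. f s (u s)) t) \<and>
    (\<forall>t\<in>{0..1}. u t \<in> {t^3 * u 1..u 1}) \<and> A \<le> u 1 \<and> u 1 \<le> B"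
proof -
  define N where "N = 4 * m"
  have N: "0 < N" using m by (simp add: N_def)
  define clamp where "clamp = (\<lambda>y::real. max 0 (min B y))"
  have clamp: "clamp y \<in> {0..B}" for y using AB by (auto simp: clamp_def)
  define F where "F = (\<lambda>(j::nat) y. f (min 1 (real j / real N)) (clamp y))"
  obtain D where D: "\<And>t x. t \<in> {0..1} \<Longrightarrow> x \<in> {0..B} \<Longrightarrow> f t x \<le> D" using f_bounded[of B] by blast
  have F_cont: "continuous_on UNIV (F j)" for j
  proof -
    have "continuous_on UNIV (\<lambda>y. (\<lambda>(t, x). f t x) (min 1 (real j / real N), clamp y))"
      by (rule continuous_on_compose2[OF f_continuous])
        (use clamp in \<open>auto simp: clamp_def intro!: continuous_intros continuous_on_max continuous_on_min\<close>)
    then show ?thesis by (simp add: F_def)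
  qed
  have F_nonneg: "0 \<le> F j y" for j y
    unfolding F_def using clamp[of y] by (intro f_nonneg) auto
  have F_bound: "\<bar>F j y\<bar> \<le> D" for j y
  proof -
    have "F j y \<le> D" unfolding F_def using clamp[of y] by (intro D) auto
    then show ?thesis using F_nonneg[of j y] by simp
  qed
  define b where "b = (\<lambda>j::nat. boundary_weight (real j / real N) / N)"
  define p where "p = (\<lambda>i::nat. (real i / real N)^3)"
  define q where "q = (\<lambda>j::nat. (1 - real j / real N)^2 / 6 / N)"
  define v where "v = (\<lambda>i j::nat. (max 0 (real i / real N - real j / real N))^3 / 6 / N)"
  define T where "T = (\<lambda>\<epsilon> N x i. \<epsilon> + (\<Sum>j<N. (b j + p i * q j - v i j) * F j (x j)))"
  have kernel: "b j + p i * q j - v i j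
      = (boundary_weight (real j / real N) + green (real i / real N) (real j / real N)) / N" for i j
    by (simp add: b_def p_def q_def v_def green_def add_divide_distrib diff_divide_distrib)
  have v0: "v i j = 0" if "i \<le> j" for i j
  proof -
    have "real i / real N \<le> real j / real N" using that by (intro divide_right_mono) auto
    then show ?thesis by (simp add: v_def)
  qed
  have T_pos: "0 \<le> T 0 N x N" for x
    unfolding T_def kernel using node_bounds N F_nonneg
    by (auto intro!: sum_nonneg mult_nonneg_nonneg divide_nonneg_nonneg add_nonneg_nonneg
        boundary_weight_nonneg green_nonneg)
  have cone: "\<exists>w. (\<forall>t. w t = quadrature \<epsilon> N (\<lambda>s. f s (\<mu> * w s)) t) \<and>
      (\<forall>s\<in>{0..1}. \<mu> * w s \<in> {s^3 * x N..x N}) \<and> T \<epsilon> N x N = w 1 \<and> x N = \<mu> * w 1"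
    if \<mu>: "0 < \<mu>" and x: "\<forall>i\<le>N. x i = \<mu> * T \<epsilon> N x i" and xN: "x N \<le> B" for x \<mu>
  proof -
    define w where "w = (\<lambda>t. \<epsilon> + (\<Sum>j<N. (boundary_weight (real j / real N) + green t (real j / real N)) * F j (x j)) / N)"
    have Tw: "T \<epsilon> N x i = w (real i / real N)" for i
      by (simp add: T_def kernel w_def sum_divide_distrib)
    define h where "h = (\<lambda>s. f s (clamp (\<mu> * w s)))"
    have h0: "0 \<le> h s" if "s \<in> {0..1}" for s
      unfolding h_def using clamp[of "\<mu> * w s"] that by (intro f_nonneg) auto
    have "F j (x j) = h (real j / real N)" if "j < N" for j
      using that x by (simp add: F_def h_def Tw)
    then have w: "w t = quadrature \<epsilon> N h t" for t
      by (simp add: w_def quadrature_def)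
    have Tw1: "T \<epsilon> N x N = w 1" using Tw[of N] N by simp
    have xN1: "x N = \<mu> * w 1" using x Tw1 by simp
    have range: "\<mu> * w s \<in> {s^3 * x N..x N}" if "s \<in> {0..1}" for s
    proof -
      have "s^3 * w 1 \<le> w s" "w s \<le> w 1"
        unfolding w using that \<epsilon> by (auto intro!: quadrature_ge_cube quadrature_mono h0)
      then have "\<mu> * (s^3 * w 1) \<le> \<mu> * w s" "\<mu> * w s \<le> \<mu> * w 1" using \<mu> by auto
      then show ?thesis by (simp add: xN1 algebra_simps)
    qed
    have "0 \<le> w 1" using quadrature_ge[of \<epsilon> h 1 N] \<epsilon> h0 by (simp add: w)
    then have "0 \<le> x N" using \<mu> by (simp add: xN1)
    then have "clamp (\<mu> * w s) = \<mu> * w s" if "s \<in> {0..1}" for s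
    proof -
      have "0 \<le> s^3 * x N" using that \<open>0 \<le> x N\<close> by simp
      then show ?thesis using range[OF that] xN by (simp add: clamp_def)
    qed
    then have "w t = quadrature \<epsilon> N (\<lambda>s. f s (\<mu> * w s)) t" for t
      unfolding w[of t] by (intro quadrature_cong) (simp add: h_def)
    with range Tw1 xN1 show ?thesis by blast
  qed
  have comp: "T \<epsilon> N x N < r"
    if cmp: "compressing r" and r: "A \<le> r" "r \<le> B"
      and x: "0 < \<mu>" "\<forall>i\<le>N. x i = \<mu> * T \<epsilon> N x i" "x N = r" for r x \<mu>
  proof -
    have xN: "x N \<le> B" using x(3) r by simp
    from cone[OF x(1,2) xN] obtain w where
      w: "\<forall>t. w t = quadrature \<epsilon> N (\<lambda>s. f s (\<mu> * w s)) t" "T \<epsilon> N x N = w 1"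
      and w_range: "\<forall>s\<in>{0..1}. \<mu> * w s \<in> {s^3 * x N..x N}"
      by blast
    have "\<mu> * w s \<in> {0..r}" if "s \<in> {0..1}" for s
    proof -
      have "0 \<le> s^3 * r" using that r AB by simp
      moreover have "s^3 * r \<le> \<mu> * w s" "\<mu> * w s \<le> r" using w_range that x(3) by auto
      ultimately show ?thesis by simp
    qed
    then have "w 1 \<le> \<epsilon> + r / 4"
      unfolding w(1)[rule_format, of 1] by (intro quadrature_compressing cmp N)
    then show ?thesis unfolding w(2) using r AB \<epsilon> by linarith
  qed
  have expa: "r < T \<epsilon> N x N"
    if ex: "expanding r" and r: "A \<le> r" "r \<le> B"
      and x: "0 < \<mu>" "\<forall>i\<le>N. x i = \<mu> * T \<epsilon> N x i" "x N = r" for r x \<mu>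
  proof -
    have xN: "x N \<le> B" using x(3) r by simp
    from cone[OF x(1,2) xN] obtain w where
      w: "\<forall>t. w t = quadrature \<epsilon> N (\<lambda>s. f s (\<mu> * w s)) t" "T \<epsilon> N x N = w 1"
      and w_range: "\<forall>s\<in>{0..1}. \<mu> * w s \<in> {s^3 * x N..x N}"
      by blast
    have "0 < r" using r AB by simp
    have "r < quadrature \<epsilon> (4 * m) (\<lambda>s. f s (\<mu> * w s)) 1"
      by (rule quadrature_expanding[OF ex \<open>0 < r\<close> m]) (use \<epsilon> w_range x(3) in auto)
    then show ?thesis
      unfolding w(2) w(1)[rule_format, of 1] by (simp add: N_def)
  qed
  have "\<exists>\<sigma>. (\<sigma> = 1 \<or> \<sigma> = (-1::real)) \<and>
     (\<forall>x \<mu>. 0 < \<mu> \<longrightarrow> (\<forall>i\<le>N. x i = \<mu> * T \<epsilon> N x i) \<longrightarrow> x N = A \<longrightarrow> \<sigma> * (T \<epsilon> N x N - A) < 0) \<and>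
     (\<forall>x \<mu>. 0 < \<mu> \<longrightarrow> (\<forall>i\<le>N. x i = \<mu> * T \<epsilon> N x i) \<longrightarrow> x N = B \<longrightarrow> \<sigma> * (T \<epsilon> N x N - B) > 0)"
    using ends
  proof
    assume c: "compressing A \<and> expanding B"
    show ?thesis
    proof (intro exI[of _ 1] conjI allI impI)
      show "1 * (T \<epsilon> N x N - A) < 0"
        if "0 < \<mu>" "\<forall>i\<le>N. x i = \<mu> * T \<epsilon> N x i" "x N = A" for x \<mu>
        using comp[OF _ _ _ that] c AB by simp
      show "1 * (T \<epsilon> N x N - B) > 0"
        if "0 < \<mu>" "\<forall>i\<le>N. x i = \<mu> * T \<epsilon> N x i" "x N = B" for x \<mu>
        using expa[OF _ _ _ that] c AB by simp
    qed simp
  next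
    assume c: "expanding A \<and> compressing B"
    show ?thesis
    proof (intro exI[of _ "-1"] conjI allI impI)
      show "-1 * (T \<epsilon> N x N - A) < 0"
        if "0 < \<mu>" "\<forall>i\<le>N. x i = \<mu> * T \<epsilon> N x i" "x N = A" for x \<mu>
        using expa[OF _ _ _ that] c AB by simp
      show "-1 * (T \<epsilon> N x N - B) > 0"
        if "0 < \<mu>" "\<forall>i\<le>N. x i = \<mu> * T \<epsilon> N x i" "x N = B" for x \<mu>
        using comp[OF _ _ _ that] c AB by simp
    qed simp
  qed
  then obtain \<sigma> where \<sigma>: "\<sigma> = 1 \<or> \<sigma> = (-1::real)"
    "\<And>x \<mu>. 0 < \<mu> \<Longrightarrow> \<forall>i\<le>N. x i = \<mu> * T \<epsilon> N x i \<Longrightarrow> x N = A \<Longrightarrow> \<sigma> * (T \<epsilon> N x N - A) < 0"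
    "\<And>x \<mu>. 0 < \<mu> \<Longrightarrow> \<forall>i\<le>N. x i = \<mu> * T \<epsilon> N x i \<Longrightarrow> x N = B \<Longrightarrow> \<sigma> * (T \<epsilon> N x N - B) > 0"
    by blast
  have "\<exists>x. (\<forall>i\<le>N. x i = T \<epsilon> N x i) \<and> A \<le> x N \<and> x N \<le> B"
    using discrete_annulus_fixed_point[where F=F and v=v and b=b and p=p and q=q and N=N, OF F_cont F_bound v0 T_pos[unfolded T_def] \<epsilon>(1) AB \<sigma>[unfolded T_def]]
    by (simp add: T_def)
  then obtain x where x: "\<forall>i\<le>N. x i = 1 * T \<epsilon> N x i" "A \<le> x N" "x N \<le> B" by auto
  from cone[OF zero_less_one x(1,3)] obtain w where
    w: "\<forall>t. w t = quadrature \<epsilon> N (\<lambda>s. f s (1 * w s)) t"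
      "\<forall>s\<in>{0..1}. 1 * w s \<in> {s^3 * x N..x N}" "x N = 1 * w 1"
    by blast
  show ?thesis
  proof (intro exI[of _ w] conjI)
    show "\<forall>t. w t = quadrature \<epsilon> (4 * m) (\<lambda>s. f s (w s)) t"
      using w(1) unfolding N_def mult_1_left .
    show "\<forall>t\<in>{0..1}. w t \<in> {t^3 * w 1..w 1}" using w(2,3) by simp
    show "A \<le> w 1" "w 1 \<le> B" using x(2,3) w(3) by simp_all
  qed
qed

section \<open>Passage to the limit\<close>

text \<open>
  Membership in the cone is recorded with the integral equation; it makes a nonzero solution
  positive and identifies its norm with its value at \<open>1\<close>.
\<close>
definition mild_solution :: "(real \<Rightarrow> real) \<Rightarrow> bool" where
  "mild_solution u \<longleftrightarrow> continuous_on {0..1} u \<and>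
     (\<forall>t\<in>{0..1}. u t = u 0 + integral {0..1} (\<lambda>s. green t s * f s (u s))) \<and>
     u 0 = \<alpha> * integral {0..1} u + (\<Sum>i=1..n. \<beta> i * u (\<eta> i)) \<and>
     (\<forall>t\<in>{0..1}. u t \<in> {t^3 * u 1..u 1})"

text \<open>
  The approximate solutions are bounded by \<open>B\<close> and share a Lipschitz constant, since Green's
  function is Lipschitz in \<open>t\<close> and \<open>f\<close> is bounded on \<open>[0, 1] \<times> [0, B]\<close>. By the Arzela-Ascoli
  theorem a subsequence converges uniformly, and the Riemann sums converge to the integral. The
  bound \<open>A \<le> u 1\<close> survives, although \<open>\<epsilon>\<close> tends to \<open>0\<close>.
\<close>
lemma mild_solution_exists:
  assumes AB: "0 < A" "A \<le> B"
    and ends: "compressing A \<and> expanding B \<or> expanding A \<and> compressing B"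
  obtains u where "mild_solution u" "A \<le> u 1" "u 1 \<le> B"
proof -
  define \<epsilon> where "\<epsilon> = (\<lambda>m. A / 4 * inverse (real (Suc m)))"
  define N where "N = (\<lambda>m. 4 * Suc m)"
  have "inverse (real (Suc m)) \<le> 1" for m by (simp add: inverse_le_1_iff)
  then have "A / 4 * inverse (real (Suc m)) \<le> A / 4 * 1" for m using AB by (intro mult_left_mono) auto
  then have "\<epsilon> m \<le> A / 4" for m by (simp add: \<epsilon>_def)
  then have \<epsilon>: "0 < \<epsilon> m" "\<epsilon> m < A / 2" for m
    using AB le_less_trans[of "\<epsilon> m" "A / 4" "A / 2"] by (simp_all add: \<epsilon>_def)
  have \<epsilon>0: "\<epsilon> \<longlonglongrightarrow> 0"
    unfolding \<epsilon>_def using tendsto_mult_left[OF LIMSEQ_inverse_real_of_nat, of "A/4"] by simp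
  have "\<forall>m. \<exists>u. (\<forall>t. u t = quadrature (\<epsilon> m) (N m) (\<lambda>s. f s (u s)) t) \<and>
    (\<forall>t\<in>{0..1}. u t \<in> {t^3 * u 1..u 1}) \<and> A \<le> u 1 \<and> u 1 \<le> B"
    unfolding N_def using quadrature_fixed_point[OF AB ends _ \<epsilon>] by blast
  from choice[OF this] obtain U where
    U: "\<And>m t. U m t = quadrature (\<epsilon> m) (N m) (\<lambda>s. f s (U m s)) t" and
    U_range: "\<And>m t. t \<in> {0..1} \<Longrightarrow> U m t \<in> {t^3 * U m 1..U m 1}" and
    U1: "\<And>m. A \<le> U m 1" "\<And>m. U m 1 \<le> B" by blast
  have U_bounds: "U m t \<in> {0..B}" if "t \<in> {0..1}" for m t
  proof -
    have "0 \<le> t^3 * U m 1" using that U1(1)[of m] AB by auto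
    then show ?thesis using U_range[OF that, of m] U1(2)[of m] by auto
  qed
  obtain D where D: "\<And>t x. t \<in> {0..1} \<Longrightarrow> x \<in> {0..B} \<Longrightarrow> f t x \<le> D" using f_bounded[of B] by blast
  have h: "0 \<le> f s (U m s)" "f s (U m s) \<le> D" if "s \<in> {0..1}" for s m
    using that U_bounds[OF that, of m] by (auto intro: f_nonneg D)
  have "0 \<le> D" using h[of 0 0] by simp
  have lip: "\<bar>U m t' - U m t\<bar> \<le> D * \<bar>t' - t\<bar>" if "t \<in> {0..1}" "t' \<in> {0..1}" for m t t'
  proof -
    have *: "\<bar>U m t' - U m t\<bar> \<le> D * \<bar>t' - t\<bar>" if "0 \<le> t" "t \<le> t'" "t' \<le> 1" for t t'
    proof -
      have "U m t' - U m t \<le> D * (t' - t)"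
        unfolding U[of m t] U[of m t'] using that \<epsilon>(1)[of m] h
        by (intro quadrature_lipschitz) (auto simp: N_def)
      moreover have "U m t \<le> U m t'"
        unfolding U[of m t] U[of m t'] using that \<epsilon>(1)[of m] h by (intro quadrature_mono) auto
      ultimately show ?thesis using that by simp
    qed
    show ?thesis
      using *[of t t'] *[of t' t] that by (cases "t \<le> t'") (auto simp: abs_minus_commute)
  qed
  have equicont: "\<exists>d>0. \<forall>m y. y \<in> {0..1} \<and> norm (x - y) < d \<longrightarrow> norm (U m x - U m y) < e"
    if "x \<in> {0..1}" "0 < e" for x e
  proof (intro exI[of _ "e / (D + 1)"] conjI allI impI)
    show "0 < e / (D + 1)" using that \<open>0 \<le> D\<close> by simp
    fix m y assume y: "y \<in> {0..1} \<and> norm (x - y) < e / (D + 1)"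
    have "norm (U m x - U m y) \<le> D * \<bar>x - y\<bar>" using lip[of y x m] that y by simp
    also have "\<dots> \<le> (D + 1) * \<bar>x - y\<bar>" by (intro mult_right_mono) auto
    also have "\<dots> < e" using y \<open>0 \<le> D\<close> by (simp add: pos_less_divide_eq mult.commute)
    finally show "norm (U m x - U m y) < e" .
  qed
  obtain u \<kappa> where u_cont: "continuous_on {0..1} u" and \<kappa>: "strict_mono (\<kappa> :: nat \<Rightarrow> nat)"
    and conv: "\<And>e. 0 < e \<Longrightarrow> \<exists>K. \<forall>n x. n \<ge> K \<and> x \<in> {0..1} \<longrightarrow> norm (U (\<kappa> n) x - u x) < e"
    by (rule Arzela_Ascoli[of "{0..1::real}" U B]) (use U_bounds equicont in auto)
  have ulim: "uniform_limit {0..1} (\<lambda>n. U (\<kappa> n)) u sequentially"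
    using conv unfolding uniform_limit_sequentially_iff dist_norm by meson
  have lim: "(\<lambda>n. U (\<kappa> n) t) \<longlonglongrightarrow> u t" if "t \<in> {0..1}" for t
    using tendsto_uniform_limitI[OF ulim that] .
  have u_range: "u t \<in> {t^3 * u 1..u 1}" if t: "t \<in> {0..1}" for t
  proof -
    have "t^3 * u 1 \<le> u t"
      by (rule LIMSEQ_le[OF tendsto_mult_left[OF lim] lim[OF t]]) (use U_range[OF t] in auto)
    moreover have "u t \<le> u 1"
      by (rule LIMSEQ_le[OF lim[OF t] lim]) (use U_range[OF t] in auto)
    ultimately show ?thesis by simp
  qed
  have u1: "A \<le> u 1" "u 1 \<le> B"
    using LIMSEQ_le_const[OF lim[of 1]] LIMSEQ_le_const2[OF lim[of 1]] U1 by auto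
  have u_bounds: "u t \<in> {0..B}" if "t \<in> {0..1}" for t
  proof -
    have "0 \<le> t^3 * u 1" using that u1(1) AB by auto
    then show ?thesis using u_range[OF that] u1(2) by auto
  qed
  have fu_cont: "continuous_on {0..1} (\<lambda>s. f s (u s))"
    using u_bounds by (intro continuous_f_comp u_cont) auto
  have N_top: "filterlim (\<lambda>n. N (\<kappa> n)) at_top sequentially"
    unfolding N_def by (rule filterlim_compose[OF _ filterlim_subseq[OF \<kappa>]])
      (auto intro!: filterlim_at_top_mono[OF filterlim_ident])
  have green_f: "uniform_limit {0..1} (\<lambda>n s. green t s * f s (U (\<kappa> n) s)) (\<lambda>s. green t s * f s (u s)) sequentially"
    if t: "t \<in> {0..1}" for t
  proof (rule uniform_limitI)
    fix e :: real assume "0 < e"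
    have "uniformly_continuous_on ({0..1} \<times> {0..B}) (\<lambda>(t, x). f t x)"
      by (intro compact_uniformly_continuous continuous_on_subset[OF f_continuous] compact_Times) auto
    then obtain d where d: "0 < d" "\<And>z z'. z \<in> {0..1} \<times> {0..B} \<Longrightarrow> z' \<in> {0..1} \<times> {0..B} \<Longrightarrow> dist z' z < d \<Longrightarrow>
        dist ((\<lambda>(t, x). f t x) z') ((\<lambda>(t, x). f t x) z) < e"
      using \<open>0 < e\<close> unfolding uniformly_continuous_on_def by meson
    from uniform_limitD[OF ulim d(1)]
    show "\<forall>\<^sub>F n in sequentially. \<forall>s\<in>{0..1}. dist (green t s * f s (U (\<kappa> n) s)) (green t s * f s (u s)) < e"
    proof eventually_elim
      case (elim n)
      show ?case
      proof
        fix s :: real assume s: "s \<in> {0..1}"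
        have "dist (f s (U (\<kappa> n) s)) (f s (u s)) < e"
          using d(2)[of "(s, u s)" "(s, U (\<kappa> n) s)"] s u_bounds[OF s] U_bounds[OF s] elim
          by (auto simp: dist_Pair_Pair)
        moreover have "0 \<le> green t s" "green t s \<le> 1"
          using s t green_nonneg[of t s] green_mono[of t 1 s] green_1_le[of s] by auto
        ultimately have "green t s * dist (f s (U (\<kappa> n) s)) (f s (u s)) < e"
          by (smt (verit) mult_left_le_one_le zero_le_dist)
        then show "dist (green t s * f s (U (\<kappa> n) s)) (green t s * f s (u s)) < e"
          using \<open>0 \<le> green t s\<close> by (simp add: dist_real_def right_diff_distrib[symmetric] abs_mult)
      qed
    qed
  qed
  have eq: "u t = u 0 + integral {0..1} (\<lambda>s. green t s * f s (u s))" if t: "t \<in> {0..1}" for t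
  proof -
    have "(\<lambda>n. (\<Sum>j<N (\<kappa> n). green t (real j / real (N (\<kappa> n))) *
        f (real j / real (N (\<kappa> n))) (U (\<kappa> n) (real j / real (N (\<kappa> n))))) / real (N (\<kappa> n)))
        \<longlonglongrightarrow> integral {0..1} (\<lambda>s. green t s * f s (u s))"
      by (rule riemann_sum_uniform_limit[OF _ green_f[OF t] N_top])
        (intro continuous_intros continuous_green fu_cont)
    moreover have "(\<Sum>j<N m. green t (real j / real (N m)) *
        f (real j / real (N m)) (U m (real j / real (N m)))) / real (N m) = U m t - U m 0" for m
      unfolding U[of m t] U[of m 0]
      by (simp add: quadrature_def green_0 distrib_right sum.distrib add_divide_distrib)
    ultimately have "(\<lambda>n. U (\<kappa> n) t - U (\<kappa> n) 0) \<longlonglongrightarrow> integral {0..1} (\<lambda>s. green t s * f s (u s))"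
      by simp
    moreover have "(\<lambda>n. U (\<kappa> n) t - U (\<kappa> n) 0) \<longlonglongrightarrow> u t - u 0"
      by (intro tendsto_diff lim t) simp
    ultimately show ?thesis using LIMSEQ_unique by fastforce
  qed
  have U_cont: "continuous_on {0..1} (U m)" for m
  proof (unfold continuous_on_iff, intro ballI allI impI)
    fix x e :: real assume "x \<in> {0..1}" "0 < e"
    from equicont[OF this] obtain d where
      d: "0 < d" "\<forall>m y. y \<in> {0..1} \<and> norm (x - y) < d \<longrightarrow> norm (U m x - U m y) < e"
      by blast
    show "\<exists>d>0. \<forall>x'\<in>{0..1}. dist x' x < d \<longrightarrow> dist (U m x') (U m x) < e"
      by (intro exI[of _ d]) (use d in \<open>auto simp: dist_real_def abs_minus_commute\<close>)
  qed
  have bc: "u 0 = \<alpha> * integral {0..1} u + (\<Sum>i=1..n. \<beta> i * u (\<eta> i))"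
  proof -
    have int: "(\<lambda>n. integral {0..1} (U (\<kappa> n))) \<longlonglongrightarrow> integral {0..1} u"
    proof -
      obtain I J where I: "\<And>n. (U (\<kappa> n) has_integral I n) {0..1}" "(u has_integral J) {0..1}" "I \<longlonglongrightarrow> J"
        using uniform_limit_integral[OF ulim] U_cont by auto
      then show ?thesis by (simp add: integral_unique[OF I(1)] integral_unique[OF I(2)])
    qed
    have \<eta>01: "\<eta> i \<in> {0..1}" if "i \<in> {1..n}" for i using \<eta>_bounds[OF that] by simp
    have sums: "(\<lambda>m. \<Sum>i=1..n. \<beta> i * U (\<kappa> m) (\<eta> i)) \<longlonglongrightarrow> (\<Sum>i=1..n. \<beta> i * u (\<eta> i))"
      by (intro tendsto_sum tendsto_mult tendsto_const lim \<eta>01)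
    have \<epsilon>\<kappa>: "(\<lambda>n. \<epsilon> (\<kappa> n)) \<longlonglongrightarrow> 0"
      using LIMSEQ_subseq_LIMSEQ[OF \<epsilon>0 \<kappa>] by (simp add: comp_def)
    have Ueq: "quadrature (\<epsilon> m) (N m) (\<lambda>s. f s (U m s)) = U m" for m
      by (rule ext) (rule U[symmetric])
    have "U m 0 = k * \<epsilon> m + \<alpha> * integral {0..1} (U m) + (\<Sum>i=1..n. \<beta> i * U m (\<eta> i))" for m
      using quadrature_boundary[of "\<epsilon> m" "N m" "\<lambda>s. f s (U m s)"] unfolding Ueq .
    moreover have "(\<lambda>m. k * \<epsilon> (\<kappa> m) + \<alpha> * integral {0..1} (U (\<kappa> m)) + (\<Sum>i=1..n. \<beta> i * U (\<kappa> m) (\<eta> i)))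
        \<longlonglongrightarrow> k * 0 + \<alpha> * integral {0..1} u + (\<Sum>i=1..n. \<beta> i * u (\<eta> i))"
      by (intro tendsto_add tendsto_mult tendsto_const int \<epsilon>\<kappa> sums)
    ultimately have "(\<lambda>n. U (\<kappa> n) 0) \<longlonglongrightarrow> \<alpha> * integral {0..1} u + (\<Sum>i=1..n. \<beta> i * u (\<eta> i))"
      by simp
    then show ?thesis using LIMSEQ_unique[OF lim[of 0]] by simp
  qed
  have "mild_solution u" unfolding mild_solution_def using u_cont eq bc u_range by blast
  then show thesis using that u1 by blast
qed

end

section \<open>Mild solutions are classical solutions\<close>

text \<open>
  Expanding the cube removes the parameter \<open>t\<close> from the integrands, so the product rule is all
  that is needed to differentiate the Volterra part of Green's operator.
\<close>
lemma integral_cube_kernel: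
  fixes h :: "real \<Rightarrow> real"
  assumes h: "continuous_on {0..1} h" and t: "t \<in> {0..1}"
  defines "J \<equiv> \<lambda>m t. integral {0..t} (\<lambda>s. s^m * h s)"
  shows "integral {0..1} (\<lambda>s. (max 0 (t - s))^3 * h s)
    = t^3 * J 0 t - 3 * t^2 * J 1 t + 3 * t * J 2 t - J 3 t"
proof -
  have int: "(\<lambda>s. s^m * h s) integrable_on {0..t}" for m
    by (rule integrable_continuous_real) (use t in \<open>auto intro!: continuous_intros continuous_on_subset[OF h]\<close>)
  have max_int: "(\<lambda>s. (max 0 (t - s))^3 * h s) integrable_on {0..1}"
    by (intro integrable_continuous_real continuous_intros continuous_on_max h)
  have "integral {0..1} (\<lambda>s. (max 0 (t - s))^3 * h s)
      = integral {0..t} (\<lambda>s. (max 0 (t - s))^3 * h s) + integral {t..1} (\<lambda>s. (max 0 (t - s))^3 * h s)"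
    by (rule Henstock_Kurzweil_Integration.integral_combine[symmetric]) (use t max_int in auto)
  also have "integral {t..1} (\<lambda>s. (max 0 (t - s))^3 * h s) = integral {t..1} (\<lambda>s. 0)"
    by (rule integral_cong) (auto simp: max_def)
  also have "integral {0..t} (\<lambda>s. (max 0 (t - s))^3 * h s)
      = integral {0..t} (\<lambda>s. t^3 * (s^0 * h s) - (3 * t^2) * (s^1 * h s) + (3 * t) * (s^2 * h s) - s^3 * h s)"
    by (rule integral_cong) (auto simp: max_def power2_eq_square power3_eq_cube algebra_simps)
  also have "\<dots> = t^3 * J 0 t - (3 * t^2) * J 1 t + (3 * t) * J 2 t - J 3 t"
    unfolding J_def
    by (intro integral_unique has_integral_diff has_integral_add has_integral_mult_right integrable_integral int)
  finally show ?thesis by simp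
qed

text \<open>
  Inside \<open>[0, 1]\<close> the operator \<open>deriv01\<close> sees only the values on \<open>[0, 1]\<close>, so a formula that
  holds there for one derivative may be inserted before the next one is taken.
\<close>
lemma deriv01_chain:
  assumes d: "\<And>j t. j < m \<Longrightarrow> t \<in> {0..1} \<Longrightarrow> (d j has_real_derivative d (Suc j) t) (at t within {0..1})"
    and u: "\<And>t. t \<in> {0..1} \<Longrightarrow> u t = d 0 t"
  shows "j \<le> m \<Longrightarrow> t \<in> {0..1} \<Longrightarrow> (deriv01 ^^ j) u t = d j t"
    and "j < m \<Longrightarrow> t \<in> {0..1} \<Longrightarrow>
      ((deriv01 ^^ j) u has_vector_derivative d (Suc j) t) (at t within {0..1})"
proof -
  have step: "((deriv01 ^^ j) u has_vector_derivative d (Suc j) t) (at t within {0..1})"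
    if "\<And>t. t \<in> {0..1} \<Longrightarrow> (deriv01 ^^ j) u t = d j t" "j < m" "t \<in> {0..1}" for j t
    using has_vector_derivative_transform[OF that(3), of "(deriv01 ^^ j) u" "d j"] that d
    by (simp add: has_real_derivative_iff_has_vector_derivative)
  show eq: "(deriv01 ^^ j) u t = d j t" if "j \<le> m" "t \<in> {0..1}" for j t
    using that
  proof (induction j arbitrary: t)
    case (Suc j)
    then have "((deriv01 ^^ j) u has_vector_derivative d (Suc j) t) (at t within {0..1})"
      by (intro step) auto
    then show ?case
      using Suc.prems by (simp add: deriv01_def[of "(deriv01 ^^ j) u"] vector_derivative_within_closed_interval)
  qed (use u in simp)
  show "((deriv01 ^^ j) u has_vector_derivative d (Suc j) t) (at t within {0..1})"
    if "j < m" "t \<in> {0..1}"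
    using that by (intro step eq) auto
qed

lemma min_quot_le:
  assumes "\<And>t. t \<in> {0..1} \<Longrightarrow> 0 \<le> f t x" "0 < x" "t \<in> {0..1}"
  shows "min_quot f x * x \<le> f t x"
proof -
  have "min_quot f x \<le> f t x / x"
    unfolding min_quot_def using assms by (intro cINF_lower bdd_belowI2[of _ 0]) auto
  then show ?thesis using assms(2) by (simp add: le_divide_eq)
qed

context nonlocal_bvp
begin

lemma mild_solution_range:
  assumes "mild_solution u" "0 \<le> u 1" "t \<in> {0..1}"
  shows "u t \<in> {0..u 1}"
proof -
  have "0 \<le> t^3 * u 1" using assms by simp
  moreover have "t^3 * u 1 \<le> u t" "u t \<le> u 1"
    using assms by (auto simp: mild_solution_def)
  ultimately show ?thesis by simp
qed

lemma mild_solution_is_positive_bvp_solution: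
  assumes mild: "mild_solution u" and u1: "0 < u 1"
  shows "positive_bvp_solution f \<alpha> n \<beta> \<eta> u"
proof -
  define h where "h = (\<lambda>s. f s (u s))"
  have u: "continuous_on {0..1} u"
    and eq: "\<And>t. t \<in> {0..1} \<Longrightarrow> u t = u 0 + integral {0..1} (\<lambda>s. green t s * h s)"
    and bc: "u 0 = \<alpha> * integral {0..1} u + (\<Sum>i=1..n. \<beta> i * u (\<eta> i))"
    and range: "\<And>t. t \<in> {0..1} \<Longrightarrow> t^3 * u 1 \<le> u t"
    using mild by (auto simp: mild_solution_def h_def)
  have u_nonneg: "0 \<le> u t" if "t \<in> {0..1}" for t
    using mild_solution_range[OF mild _ that] u1 by simp
  have u_pos: "0 < u t" if "t \<in> {0<..<1}" for t
  proof -
    have "0 < t^3 * u 1" using that u1 by simp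
    then show ?thesis using range[of t] that by simp
  qed
  have h: "continuous_on {0..1} h"
    unfolding h_def using u_nonneg by (intro continuous_f_comp u)
  define J where "J = (\<lambda>m t. integral {0..t} (\<lambda>s. s^m * h s))"
  define Q where "Q = J 0 1 - 2 * J 1 1 + J 2 1"
  have mom: "(\<lambda>s. s^m * h s) integrable_on {0..1}" for m
    by (intro integrable_continuous_real continuous_intros h)
  have J: "(J m has_real_derivative t^m * h t) (at t within {0..1})" if "t \<in> {0..1}" for m t
    unfolding J_def using that by (intro integral_has_real_derivative continuous_intros h)
  have Q: "integral {0..1} (\<lambda>s. (1 - s)^2 * h s) = Q"
  proof -
    have "integral {0..1} (\<lambda>s. (1 - s)^2 * h s)
        = integral {0..1} (\<lambda>s. s^0 * h s - 2 * (s^1 * h s) + s^2 * h s)"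
      by (rule integral_cong) (auto simp: power2_eq_square algebra_simps)
    also have "\<dots> = Q"
      unfolding Q_def J_def
      by (intro integral_unique has_integral_diff has_integral_add has_integral_mult_right
          integrable_integral mom)
    finally show ?thesis .
  qed
  \<comment> \<open>the successive derivatives of \<open>u\<close>, in terms of the moments \<open>J\<close>; the terms
     that arise from differentiating the moments cancel\<close>
  define d where "d = (\<lambda>(j::nat) t.
     if j = 0 then u 0 + (t^3 * Q - (t^3 * J 0 t - 3 * t^2 * J 1 t + 3 * t * J 2 t - J 3 t)) / 6
     else if j = 1 then (t^2 * Q - (t^2 * J 0 t - 2 * t * J 1 t + J 2 t)) / 2
     else if j = 2 then t * Q - (t * J 0 t - J 1 t)
     else if j = 3 then Q - J 0 t
     else - h t)"
  have d0: "u t = d 0 t" if t: "t \<in> {0..1}" for t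
  proof -
    have "integral {0..1} (\<lambda>s. green t s * h s)
        = integral {0..1} (\<lambda>s. (t^3 / 6) * ((1 - s)^2 * h s) - (1/6) * ((max 0 (t - s))^3 * h s))"
      by (rule integral_cong) (simp add: green_def field_simps)
    also have "\<dots> = (t^3 / 6) * Q - (1/6) * integral {0..1} (\<lambda>s. (max 0 (t - s))^3 * h s)"
      unfolding Q[symmetric]
      by (intro integral_unique has_integral_diff has_integral_mult_right integrable_integral
          integrable_continuous_real continuous_intros continuous_on_max h)
    finally show ?thesis
      using eq[OF t] unfolding integral_cube_kernel[OF h t] by (simp add: d_def J_def diff_divide_distrib)
  qed
  have deriv: "(d j has_real_derivative d (Suc j) t) (at t within {0..1})" if j: "j < 4" and t: "t \<in> {0..1}" for j t
  proof -
    consider "j = 0" | "j = 1" | "j = 2" | "j = 3" using j by linarith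
    then show ?thesis
    proof cases
      case 1
      then show ?thesis unfolding d_def
        by (auto intro!: derivative_eq_intros J[OF t] simp: field_simps power2_eq_square power3_eq_cube)
    next
      case 2
      then show ?thesis unfolding d_def
        by (auto intro!: derivative_eq_intros J[OF t] simp: field_simps power2_eq_square)
    next
      case 3
      then show ?thesis unfolding d_def
        by (auto intro!: derivative_eq_intros J[OF t])
    next
      case 4
      then show ?thesis unfolding d_def
        by (auto intro!: derivative_eq_intros J[OF t])
    qed
  qed
  have D: "(deriv01 ^^ j) u t = d j t" if "j \<le> 4" "t \<in> {0..1}" for j t
    using deriv01_chain(1)[of 4 d u j t] deriv d0 that by blast
  have D': "((deriv01 ^^ j) u has_vector_derivative d (Suc j) t) (at t within {0..1})"
    if "j < 4" "t \<in> {0..1}" for j t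
    using deriv01_chain(2)[of 4 d u j t] deriv d0 that by blast
  have "C_diff01 4 u"
    unfolding C_diff01_def
  proof (intro conjI allI impI)
    show "(deriv01 ^^ j) u differentiable_on {0..1}" if "j < 4" for j
      unfolding differentiable_on_def
    proof
      fix t :: real assume "t \<in> {0..1}"
      from D'[OF that this] show "(deriv01 ^^ j) u differentiable at t within {0..1}"
        unfolding has_vector_derivative_def differentiable_def by blast
    qed
    have "continuous_on {0..1} (\<lambda>t. - h t)" by (intro continuous_intros h)
    then show "continuous_on {0..1} ((deriv01 ^^ 4) u)"
      using D[of 4] by (subst continuous_on_cong[OF refl, of _ _ "\<lambda>t. - h t"]) (auto simp: d_def)
  qed
  moreover have "(deriv01 ^^ 4) u t + f t (u t) = 0" if "t \<in> {0<..<1}" for t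
    using D[of 4 t] that by (simp add: d_def h_def)
  moreover have "deriv01 u 0 = 0" "deriv01 u 1 = 0" "(deriv01 ^^ 2) u 0 = 0"
    using D[of 1 0] D[of 1 1] D[of 2 0] by (auto simp: d_def Q_def J_def)
  ultimately show ?thesis
    unfolding positive_bvp_solution_def bvp_solution_def
    using u_nonneg u_pos bc by auto
qed

text \<open>
  At \<open>t = 1\<close> the integral equation and \<open>u(0) \<le> (1 - k) * u(1)\<close> give
  \<open>k * u(1) \<le> \<integral> green 1 s * f s (u s) ds\<close>, where \<open>green 1 s \<le> 1/24\<close>. In particular the norm of
  a nonzero solution is never equal to \<open>r\<close>.
\<close>
lemma compressing_mild_solution_small:
  assumes mild: "mild_solution u" "0 \<le> u 1" and r: "compressing r" "u 1 \<le> r"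
  shows "u 1 \<le> r / 4"
proof -
  have u: "continuous_on {0..1} u"
    and eq: "u 1 = u 0 + integral {0..1} (\<lambda>s. green 1 s * f s (u s))"
    and bc: "u 0 = \<alpha> * integral {0..1} u + (\<Sum>i=1..n. \<beta> i * u (\<eta> i))"
    using mild by (auto simp: mild_solution_def)
  note range = mild_solution_range[OF mild]
  have h: "continuous_on {0..1} (\<lambda>s. f s (u s))"
    using range by (intro continuous_f_comp u) simp
  have "u 0 \<le> (1 - k) * u 1"
    unfolding bc using u range by (intro nonlocal_functional_le) auto
  moreover have "integral {0..1} (\<lambda>s. green 1 s * f s (u s)) \<le> integral {0..1::real} (\<lambda>s. k * r / 4)"
  proof (rule integral_le)
    show "(\<lambda>s. green 1 s * f s (u s)) integrable_on {0..1}"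
      by (intro integrable_continuous_real continuous_intros continuous_green h)
    fix s :: real assume s: "s \<in> {0..1}"
    have "green 1 s * f s (u s) \<le> (1/24) * (6 * k * r)"
      using s range[OF s] r green_nonneg[of 1 s] green_1_le[of s]
      by (intro mult_mono) (auto simp: compressing_def intro: f_nonneg)
    then show "green 1 s * f s (u s) \<le> k * r / 4" by simp
  qed auto
  ultimately have "u 1 \<le> (1 - k) * u 1 + k * r / 4" using eq by simp
  then have "k * u 1 \<le> k * (r / 4)" by (simp add: algebra_simps)
  then show ?thesis using k_pos by simp
qed

lemma positive_solution_in_annulus:
  assumes AB: "0 < A" "A \<le> B"
    and ends: "compressing A \<and> expanding B \<or> expanding A \<and> compressing B"
  obtains u where "positive_bvp_solution f \<alpha> n \<beta> \<eta> u"
    and "A \<le> sup_norm01 u" "sup_norm01 u \<le> B"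
    and "\<And>r. compressing r \<Longrightarrow> sup_norm01 u \<noteq> r"
proof -
  obtain u where u: "mild_solution u" "A \<le> u 1" "u 1 \<le> B"
    by (rule mild_solution_exists[OF AB ends])
  have u1: "0 < u 1" using u AB by simp
  note range = mild_solution_range[OF u(1) less_imp_le[OF u1]]
  have norm: "sup_norm01 u = u 1"
    unfolding sup_norm01_def
  proof (rule cSup_eq_maximum)
    have "\<bar>u 1\<bar> = u 1" using range[of 1] by simp
    then show "u 1 \<in> (\<lambda>t. \<bar>u t\<bar>) ` {0..1}" by (metis atLeastAtMost_iff image_eqI order_refl zero_le_one)
    fix y assume "y \<in> (\<lambda>t. \<bar>u t\<bar>) ` {0..1}"
    then show "y \<le> u 1" using range by auto
  qed
  show thesis
  proof (rule that)
    show "positive_bvp_solution f \<alpha> n \<beta> \<eta> u"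
      using u(1) u1 by (rule mild_solution_is_positive_bvp_solution)
    show "A \<le> sup_norm01 u" "sup_norm01 u \<le> B" using u norm by auto
    fix r assume "compressing r"
    then have "u 1 \<le> r \<Longrightarrow> u 1 \<le> r / 4"
      using compressing_mild_solution_small[of u r] u(1) u1 by simp
    then show "sup_norm01 u \<noteq> r" using norm u1 by auto
  qed
qed

end

section \<open>Two positive solutions\<close>

theorem theorem4p1:
  fixes f :: "real \<Rightarrow> real \<Rightarrow> real"
    and n :: nat
    and \<alpha> k \<Lambda>\<^sub>1 \<rho>\<^sub>1 M\<^sub>1 :: real
    and \<beta> \<eta> :: "nat \<Rightarrow> real"
  assumes "n \<ge> 1"
    and "continuous_on ({0..1} \<times> {0..}) (\<lambda>(t, u). f t u)"
    and "\<And>t u. t \<in> {0..1} \<Longrightarrow> u \<ge> 0 \<Longrightarrow> f t u \<ge> 0"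
    and "\<alpha> \<ge> 0"
    and "\<And>i. i \<in> {1..n} \<Longrightarrow> \<beta> i \<ge> 0"
    and "0 < \<eta> 1"
    and "strict_mono_on {1..n} \<eta>"
    and "\<eta> n < 1"
    and "\<alpha> + (\<Sum>i=1..n. \<beta> i) < 1"
    and "k = 1 - (\<alpha> + (\<Sum>i=1..n. \<beta> i))"
    and "\<Lambda>\<^sub>1 = 6 * k"
    and "f_zero_is f \<infinity>"
    and "f_infinity_is f \<infinity>"
    and "\<rho>\<^sub>1 > 0"
    and "M\<^sub>1 \<in> {0<..\<Lambda>\<^sub>1}"
    and "\<And>t u. u \<in> {0<..\<rho>\<^sub>1} \<Longrightarrow> t \<in> {0..1} \<Longrightarrow> f t u \<le> M\<^sub>1 * \<rho>\<^sub>1"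
  shows "\<exists>u\<^sub>1 u\<^sub>2.
    positive_bvp_solution f \<alpha> n \<beta> \<eta> u\<^sub>1 \<and>
    positive_bvp_solution f \<alpha> n \<beta> \<eta> u\<^sub>2 \<and>
    0 < sup_norm01 u\<^sub>1 \<and> sup_norm01 u\<^sub>1 < \<rho>\<^sub>1 \<and> \<rho>\<^sub>1 < sup_norm01 u\<^sub>2"
proof -
  have \<eta>: "\<eta> i \<in> {0<..<1}" if "i \<in> {1..n}" for i
    using strict_mono_on_leD[OF \<open>strict_mono_on {1..n} \<eta>\<close>, of 1 i]
      strict_mono_on_leD[OF \<open>strict_mono_on {1..n} \<eta>\<close>, of i n] that \<open>0 < \<eta> 1\<close> \<open>\<eta> n < 1\<close> by auto
  interpret nonlocal_bvp f \<alpha> k n \<beta> \<eta>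
    by unfold_locales (use assms(2-5,9,10) \<eta> in auto)
  have superlinear: "100000 * x \<le> f t x" if "ereal 100000 < ereal (min_quot f x)" "0 < x" "t \<in> {0..1}" for t x
  proof -
    have "100000 < min_quot f x" using that(1) by simp
    then have "100000 * x \<le> min_quot f x * x" using that(2) by simp
    also have "\<dots> \<le> f t x" using that by (intro min_quot_le f_nonneg) auto
    finally show ?thesis .
  qed
  obtain x\<^sub>1 where x\<^sub>1: "0 < x\<^sub>1" "\<And>x. 0 < x \<Longrightarrow> x < x\<^sub>1 \<Longrightarrow> ereal 100000 < ereal (min_quot f x)"
    using order_tendstoD(1)[OF \<open>f_zero_is f \<infinity>\<close>[unfolded f_zero_is_def], of "ereal 100000"]
    by (auto simp: eventually_at_right_field)
  obtain x\<^sub>2 where x\<^sub>2: "\<And>x. x\<^sub>2 \<le> x \<Longrightarrow> ereal 100000 < ereal (min_quot f x)"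
    using order_tendstoD(1)[OF \<open>f_infinity_is f \<infinity>\<close>[unfolded f_infinity_is_def], of "ereal 100000"]
    by (auto simp: eventually_at_top_linorder)
  \<comment> \<open>the assumed bound holds for positive arguments, and extends to \<open>0\<close> by continuity\<close>
  have mid: "compressing \<rho>\<^sub>1"
    unfolding compressing_def
  proof (intro ballI)
    fix t x :: real assume t: "t \<in> {0..1}" and x: "x \<in> {0..\<rho>\<^sub>1}"
    have "continuous_on {0..\<rho>\<^sub>1} (\<lambda>x. (\<lambda>(t, x). f t x) (t, x))"
      by (rule continuous_on_compose2[OF f_continuous]) (use t in \<open>auto intro!: continuous_intros\<close>)
    moreover have cl: "closure {0<..\<rho>\<^sub>1} = {0..\<rho>\<^sub>1}"
      using \<open>\<rho>\<^sub>1 > 0\<close> by (rule closure_greaterThanAtMost)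
    ultimately have "continuous_on (closure {0<..\<rho>\<^sub>1}) (f t)" by simp
    then have "f t x \<le> M\<^sub>1 * \<rho>\<^sub>1"
      by (rule continuous_le_on_closure) (use x cl in simp, rule assms(16)[OF _ t])
    also have "\<dots> \<le> 6 * k * \<rho>\<^sub>1" using assms(11,14,15) by (intro mult_right_mono) auto
    finally show "f t x \<le> 6 * k * \<rho>\<^sub>1" .
  qed
  define A where "A = min (x\<^sub>1 / 2) \<rho>\<^sub>1"
  have A: "0 < A" "A \<le> \<rho>\<^sub>1" "A < x\<^sub>1" using x\<^sub>1 \<open>\<rho>\<^sub>1 > 0\<close> by (auto simp: A_def)
  have low: "expanding A"
    unfolding expanding_def using A by (intro ballI superlinear x\<^sub>1) auto
  define B where "B = max (64 * x\<^sub>2) \<rho>\<^sub>1"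
  have B: "\<rho>\<^sub>1 \<le> B" "x\<^sub>2 \<le> B / 64" by (auto simp: B_def)
  have high: "expanding B"
    unfolding expanding_def using B \<open>\<rho>\<^sub>1 > 0\<close> by (intro ballI superlinear x\<^sub>2) auto
  obtain u\<^sub>1 where u\<^sub>1: "positive_bvp_solution f \<alpha> n \<beta> \<eta> u\<^sub>1"
    "A \<le> sup_norm01 u\<^sub>1" "sup_norm01 u\<^sub>1 \<le> \<rho>\<^sub>1" "sup_norm01 u\<^sub>1 \<noteq> \<rho>\<^sub>1"
    using positive_solution_in_annulus[OF A(1,2)] low mid by metis
  obtain u\<^sub>2 where u\<^sub>2: "positive_bvp_solution f \<alpha> n \<beta> \<eta> u\<^sub>2"
    "\<rho>\<^sub>1 \<le> sup_norm01 u\<^sub>2" "sup_norm01 u\<^sub>2 \<noteq> \<rho>\<^sub>1"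
    using positive_solution_in_annulus[OF \<open>\<rho>\<^sub>1 > 0\<close> B(1)] high mid by metis
  show ?thesis
    using u\<^sub>1 u\<^sub>2 A by (intro exI[of _ u\<^sub>1] exI[of _ u\<^sub>2]) auto
qed

end
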